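(* Let $M$ be a $\mathcal{Z}$-manifold. Assume that all germs of CR distributions on $M$ that are locally $L^2$ are smooth. Then, for every open connected subset $\Omega$ of $M$, we have $$|f(p)|<\sup_{\Omega}|f|,\quad\forall p\in\Omega,\qquad\text{for all non constant } f\in\mathcal{O}_M(\Omega).$$
   Context: A $\mathcal{Z}$-manifold is a smooth real manifold $M$ endowed with a $C^\infty_M$-submodule $\mathcal{Z}$ of the sheaf of germs of smooth complex vector fields on $M$ (no integrability or rank condition is assumed). A function or distribution $u$ is CR if $Zu=0$ for all $Z\in\mathcal{Z}(M)$. $\mathcal{O}_M(\Omega)$ is the space of smooth complex valued CR functions on the open set $\Omega$. *)

theory Defs
  imports "HOL-Analysis.Analysis"
begin

section \<open>Smooth maps and distributions on open subsets of Euclidean space\<close>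

text \<open>\<open>Ck_on k S f\<close> and \<open>smooth_on S f\<close> are meant for open \<open>S\<close>; they depend only on the
  restriction of \<open>f\<close> to \<open>S\<close>.\<close>

primrec Ck_on ::
    "nat \<Rightarrow> 'a::euclidean_space set \<Rightarrow> ('a \<Rightarrow> 'b::real_normed_vector) \<Rightarrow> bool" where
  "Ck_on 0 S f \<longleftrightarrow> continuous_on S f"
| "Ck_on (Suc k) S f \<longleftrightarrow>
     (\<forall>x\<in>S. f differentiable (at x)) \<and>
     (\<forall>v. Ck_on k S (\<lambda>x. frechet_derivative f (at x) v))"

definition smooth_on :: "'a::euclidean_space set \<Rightarrow> ('a \<Rightarrow> 'b::real_normed_vector) \<Rightarrow> bool" where
  "smooth_on S f \<longleftrightarrow> (\<forall>k. Ck_on k S f)"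

definition partial :: "'n \<Rightarrow> (real^'n \<Rightarrow> complex) \<Rightarrow> real^'n \<Rightarrow> complex" where
  "partial j f x = frechet_derivative f (at x) (axis j 1)"

definition iter_partial :: "'n list \<Rightarrow> (real^'n \<Rightarrow> complex) \<Rightarrow> real^'n \<Rightarrow> complex" where
  "iter_partial js f = foldr partial js f"

definition tsupp :: "(real^'n \<Rightarrow> complex) \<Rightarrow> (real^'n) set" where
  "tsupp \<phi> = closure {x. \<phi> x \<noteq> 0}"

definition test_functions :: "(real^'n) set \<Rightarrow> (real^'n \<Rightarrow> complex) set" where
  "test_functions W = {\<phi>. smooth_on UNIV \<phi> \<and> compact (tsupp \<phi>) \<and> tsupp \<phi> \<subseteq> W}"

text \<open>Distributions on an open set \<open>W\<close>; the values of the functional outside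
  \<open>test_functions W\<close> are irrelevant. Running over lists of indices instead of multi-indices
  only repeats some of the derivatives in the continuity estimate.\<close>

definition distribution_on :: "(real^'n) set \<Rightarrow> ((real^'n \<Rightarrow> complex) \<Rightarrow> complex) \<Rightarrow> bool" where
  "distribution_on W T \<longleftrightarrow>
     (\<forall>\<phi>\<in>test_functions W. \<forall>\<psi>\<in>test_functions W. T (\<lambda>x. \<phi> x + \<psi> x) = T \<phi> + T \<psi>) \<and>
     (\<forall>c. \<forall>\<phi>\<in>test_functions W. T (\<lambda>x. c * \<phi> x) = c * T \<phi>) \<and>
     (\<forall>K. compact K \<and> K \<subseteq> W \<longrightarrow>
        (\<exists>C k. \<forall>\<phi>\<in>test_functions W. tsupp \<phi> \<subseteq> K \<longrightarrow>
           cmod (T \<phi>) \<le> C * (\<Sum>js | length js \<le> k. SUP x. cmod (iter_partial js \<phi> x))))"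

definition dist_partial ::
    "'n \<Rightarrow> ((real^'n \<Rightarrow> complex) \<Rightarrow> complex) \<Rightarrow> (real^'n \<Rightarrow> complex) \<Rightarrow> complex" where
  "dist_partial j T \<phi> = - T (partial j \<phi>)"

definition dist_mult ::
    "(real^'n \<Rightarrow> complex) \<Rightarrow> ((real^'n \<Rightarrow> complex) \<Rightarrow> complex) \<Rightarrow> (real^'n \<Rightarrow> complex) \<Rightarrow> complex" where
  "dist_mult a T \<phi> = T (\<lambda>x. a x * \<phi> x)"

definition L2_loc :: "(real^'n) set \<Rightarrow> (real^'n \<Rightarrow> complex) \<Rightarrow> bool" where
  "L2_loc W h \<longleftrightarrow>
     h \<in> borel_measurable (lebesgue_on W) \<and>
     (\<forall>K. compact K \<and> K \<subseteq> W \<longrightarrow> integrable (lebesgue_on K) (\<lambda>x. (cmod (h x))\<^sup>2))"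


section \<open>Smooth manifolds\<close>

text \<open>A chart is a pair of a domain and a coordinate map; only the values of the coordinate map
  on the domain matter. The manifold is the whole (Hausdorff, second countable) type \<open>'m\<close>.\<close>

type_synonym ('m, 'n) chart = "'m set \<times> ('m \<Rightarrow> real^'n)"

abbreviation chart_dom :: "('m, 'n) chart \<Rightarrow> 'm set" where
  "chart_dom \<kappa> \<equiv> fst \<kappa>"

abbreviation chart_map :: "('m, 'n) chart \<Rightarrow> 'm \<Rightarrow> real^'n" where
  "chart_map \<kappa> \<equiv> snd \<kappa>"

abbreviation chart_inv :: "('m, 'n) chart \<Rightarrow> real^'n \<Rightarrow> 'm" where
  "chart_inv \<kappa> \<equiv> inv_into (chart_dom \<kappa>) (chart_map \<kappa>)"

abbreviation chart_img :: "('m, 'n) chart \<Rightarrow> 'm set \<Rightarrow> (real^'n) set" where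
  "chart_img \<kappa> U \<equiv> chart_map \<kappa> ` (chart_dom \<kappa> \<inter> U)"

abbreviation transition :: "('m, 'n) chart \<Rightarrow> ('m, 'n) chart \<Rightarrow> real^'n \<Rightarrow> real^'n" where
  "transition \<kappa> \<kappa>' \<equiv> chart_map \<kappa>' \<circ> chart_inv \<kappa>"

definition smooth_atlas ::
    "('m::{t2_space, second_countable_topology}, 'n::finite) chart set \<Rightarrow> bool" where
  "smooth_atlas A \<longleftrightarrow>
     (\<Union>\<kappa>\<in>A. chart_dom \<kappa>) = UNIV \<and>
     (\<forall>\<kappa>\<in>A. open (chart_dom \<kappa>) \<and> open (chart_img \<kappa> UNIV) \<and>
        homeomorphism (chart_dom \<kappa>) (chart_img \<kappa> UNIV) (chart_map \<kappa>) (chart_inv \<kappa>)) \<and>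
     (\<forall>\<kappa>\<in>A. \<forall>\<kappa>'\<in>A. smooth_on (chart_img \<kappa> (chart_dom \<kappa>')) (transition \<kappa> \<kappa>'))"

definition smooth_functions ::
    "('m::topological_space, 'n::finite) chart set \<Rightarrow> 'm set \<Rightarrow> ('m \<Rightarrow> complex) set" where
  "smooth_functions A U = {f. \<forall>\<kappa>\<in>A. smooth_on (chart_img \<kappa> U) (f \<circ> chart_inv \<kappa>)}"

definition smooth_near ::
    "('m::topological_space, 'n::finite) chart set \<Rightarrow> 'm \<Rightarrow> ('m \<Rightarrow> complex) \<Rightarrow> bool" where
  "smooth_near A p f \<longleftrightarrow> (\<exists>V. open V \<and> p \<in> V \<and> f \<in> smooth_functions A V)"


section \<open>Complex vector fields\<close>

text \<open>The coordinate vector \<open>\<partial>/\<partial>x\<^sub>j\<close> at \<open>p\<close>, as a functional on the functions that are smooth near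
  \<open>p\<close>. All other functions are sent to \<open>0\<close>, so that a tangent vector is a unique functional.\<close>

definition coord_vector ::
    "('m::topological_space, 'n::finite) chart set \<Rightarrow> ('m, 'n) chart \<Rightarrow> 'n \<Rightarrow> 'm \<Rightarrow> ('m \<Rightarrow> complex) \<Rightarrow> complex" where
  "coord_vector A \<kappa> j p f =
     (if smooth_near A p f then partial j (f \<circ> chart_inv \<kappa>) (chart_map \<kappa> p) else 0)"

text \<open>The complexified tangent space at \<open>p\<close>: complex combinations of coordinate vectors. By the
  chain rule it makes no difference whether one or all of the charts at \<open>p\<close> are used.\<close>

definition complex_tangent_space ::
    "('m::topological_space, 'n::finite) chart set \<Rightarrow> 'm \<Rightarrow> (('m \<Rightarrow> complex) \<Rightarrow> complex) set" where
  "complex_tangent_space A p =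
     {v. \<forall>\<kappa>\<in>A. p \<in> chart_dom \<kappa> \<longrightarrow>
        (\<exists>c. v = (\<lambda>f. \<Sum>j\<in>UNIV. c j * coord_vector A \<kappa> j p f))}"

type_synonym 'm vfield = "'m \<Rightarrow> ('m \<Rightarrow> complex) \<Rightarrow> complex"

text \<open>A field on \<open>U\<close> is extended by zero outside \<open>U\<close>, so that equality of fields on \<open>U\<close> is
  equality of functions. The extension need not be smooth.\<close>

definition vector_fields ::
    "('m::topological_space, 'n::finite) chart set \<Rightarrow> 'm set \<Rightarrow> 'm vfield set" where
  "vector_fields A U = {X.
     (\<forall>p\<in>U. X p \<in> complex_tangent_space A p) \<and>
     (\<forall>p. p \<notin> U \<longrightarrow> X p = (\<lambda>_. 0)) \<and>
     (\<forall>V f. open V \<and> V \<subseteq> U \<and> f \<in> smooth_functions A V \<longrightarrow>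
        (\<lambda>p. X p f) \<in> smooth_functions A V)}"

definition restrict_vf :: "'m set \<Rightarrow> 'm vfield \<Rightarrow> 'm vfield" where
  "restrict_vf V X = (\<lambda>p. if p \<in> V then X p else (\<lambda>_. 0))"

text \<open>Subsheaves of \<open>C\<^sup>\<infinity>\<close>-submodules of the sheaf of smooth complex vector fields, where
  \<open>C\<^sup>\<infinity>\<close> is the sheaf of smooth complex valued functions. Only the values of \<open>Z\<close> at open sets
  matter.\<close>

definition vf_submodule_sheaf ::
    "('m::topological_space, 'n::finite) chart set \<Rightarrow> ('m set \<Rightarrow> 'm vfield set) \<Rightarrow> bool" where
  "vf_submodule_sheaf A Z \<longleftrightarrow> (\<forall>U. open U \<longrightarrow>
     Z U \<subseteq> vector_fields A U \<and>
     (\<lambda>p f. 0) \<in> Z U \<and>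
     (\<forall>X\<in>Z U. \<forall>Y\<in>Z U. (\<lambda>p f. X p f + Y p f) \<in> Z U) \<and>
     (\<forall>g\<in>smooth_functions A U. \<forall>X\<in>Z U. (\<lambda>p f. g p * X p f) \<in> Z U) \<and>
     (\<forall>V. open V \<and> V \<subseteq> U \<longrightarrow> (\<forall>X\<in>Z U. restrict_vf V X \<in> Z V)) \<and>
     (\<forall>X\<in>vector_fields A U.
        (\<forall>p\<in>U. \<exists>V. open V \<and> p \<in> V \<and> V \<subseteq> U \<and> restrict_vf V X \<in> Z V) \<longrightarrow> X \<in> Z U))"

definition Z_manifold ::
    "('m::{t2_space, second_countable_topology}, 'n::finite) chart set \<Rightarrow> ('m set \<Rightarrow> 'm vfield set) \<Rightarrow> bool" where
  "Z_manifold A Z \<longleftrightarrow> smooth_atlas A \<and> vf_submodule_sheaf A Z"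

definition CR_functions ::
    "('m::topological_space, 'n::finite) chart set \<Rightarrow> ('m set \<Rightarrow> 'm vfield set) \<Rightarrow> 'm set \<Rightarrow> ('m \<Rightarrow> complex) set" where
  "CR_functions A Z U =
     {f \<in> smooth_functions A U. \<forall>X\<in>Z UNIV. \<forall>p\<in>U. X p f = 0}"


section \<open>Distributions on manifolds\<close>

text \<open>Following Hoermander (The Analysis of Linear Partial Differential Operators I, Section 6.3),
  a distribution \<open>u\<close> on an open set \<open>U\<close> is a family of distributions \<open>u \<kappa>\<close> on the images of
  \<open>U\<close> under the charts of an atlas, with \<open>u \<kappa>\<close> being the pullback of \<open>u \<kappa>'\<close> under
  the transition map: on overlaps
  \<open>\<langle>u \<kappa>', \<phi>\<rangle> = \<langle>u \<kappa>, (\<phi> \<circ> \<tau>) \<bar>det D\<tau>\<bar>\<rangle>\<close>, where \<open>\<tau> = \<kappa>' \<circ> \<kappa>\<^sup>-\<^sup>1\<close>. These are the generalised functions on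
  \<open>U\<close>, of which the functions form a subspace without a choice of a measure.\<close>

type_synonym ('m, 'n) mdist = "('m, 'n) chart \<Rightarrow> (real^'n \<Rightarrow> complex) \<Rightarrow> complex"

definition pull_test ::
    "('m, 'n::finite) chart \<Rightarrow> ('m, 'n) chart \<Rightarrow> 'm set \<Rightarrow> (real^'n \<Rightarrow> complex) \<Rightarrow> real^'n \<Rightarrow> complex" where
  "pull_test \<kappa> \<kappa>' U \<phi> y =
     (if y \<in> chart_img \<kappa> (chart_dom \<kappa>' \<inter> U)
      then \<phi> (transition \<kappa> \<kappa>' y) *
           of_real \<bar>det (matrix (frechet_derivative (transition \<kappa> \<kappa>') (at y)))\<bar>
      else 0)"

definition mdistribution ::
    "('m::topological_space, 'n::finite) chart set \<Rightarrow> 'm set \<Rightarrow> ('m, 'n) mdist \<Rightarrow> bool" where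
  "mdistribution A U u \<longleftrightarrow>
     (\<forall>\<kappa>\<in>A. distribution_on (chart_img \<kappa> U) (u \<kappa>)) \<and>
     (\<forall>\<kappa>\<in>A. \<forall>\<kappa>'\<in>A. \<forall>\<phi>\<in>test_functions (chart_img \<kappa>' (chart_dom \<kappa> \<inter> U)).
        u \<kappa>' \<phi> = u \<kappa> (pull_test \<kappa> \<kappa>' U \<phi>))"

definition mdist_eq_on ::
    "('m::topological_space, 'n::finite) chart set \<Rightarrow> 'm set \<Rightarrow> ('m, 'n) mdist \<Rightarrow> ('m, 'n) mdist \<Rightarrow> bool" where
  "mdist_eq_on A U u v \<longleftrightarrow> (\<forall>\<kappa>\<in>A. \<forall>\<phi>\<in>test_functions (chart_img \<kappa> U). u \<kappa> \<phi> = v \<kappa> \<phi>)"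

definition mdist_of_function :: "'m set \<Rightarrow> ('m \<Rightarrow> complex) \<Rightarrow> ('m, 'n::finite) mdist" where
  "mdist_of_function U g = (\<lambda>\<kappa> \<phi>.
     integral\<^sup>L (lebesgue_on (chart_img \<kappa> U)) (\<lambda>y. g (chart_inv \<kappa> y) * \<phi> y))"

text \<open>The coefficients \<open>a\<^sub>j = X x\<^sub>j\<close> of \<open>X = \<Sum>\<^sub>j a\<^sub>j \<partial>/\<partial>x\<^sub>j\<close> in the coordinates of a chart.\<close>

definition vf_coeff ::
    "('m, 'n::finite) chart \<Rightarrow> 'm vfield \<Rightarrow> 'n \<Rightarrow> real^'n \<Rightarrow> complex" where
  "vf_coeff \<kappa> X j y = X (chart_inv \<kappa> y) (\<lambda>q. of_real (chart_map \<kappa> q $ j))"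

definition vf_apply_mdist :: "'m vfield \<Rightarrow> ('m, 'n::finite) mdist \<Rightarrow> ('m, 'n) mdist" where
  "vf_apply_mdist X u = (\<lambda>\<kappa> \<phi>.
     \<Sum>j\<in>UNIV. dist_mult (vf_coeff \<kappa> X j) (dist_partial j (u \<kappa>)) \<phi>)"

definition CR_distribution ::
    "('m::topological_space, 'n::finite) chart set \<Rightarrow> ('m set \<Rightarrow> 'm vfield set) \<Rightarrow> 'm set \<Rightarrow> ('m, 'n) mdist \<Rightarrow> bool" where
  "CR_distribution A Z U u \<longleftrightarrow>
     mdistribution A U u \<and>
     (\<forall>X\<in>Z UNIV. mdist_eq_on A U (vf_apply_mdist X u) (\<lambda>\<kappa> \<phi>. 0))"

definition locally_L2 ::
    "('m::topological_space, 'n::finite) chart set \<Rightarrow> 'm set \<Rightarrow> ('m, 'n) mdist \<Rightarrow> bool" where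
  "locally_L2 A U u \<longleftrightarrow>
     (\<exists>g. (\<forall>\<kappa>\<in>A. L2_loc (chart_img \<kappa> U) (g \<circ> chart_inv \<kappa>)) \<and>
          mdist_eq_on A U u (mdist_of_function U g))"

definition smooth_mdist ::
    "('m::topological_space, 'n::finite) chart set \<Rightarrow> 'm set \<Rightarrow> ('m, 'n) mdist \<Rightarrow> bool" where
  "smooth_mdist A U u \<longleftrightarrow>
     (\<exists>g\<in>smooth_functions A U. mdist_eq_on A U u (mdist_of_function U g))"

text \<open>A germ of a distribution at \<open>p\<close> is represented by a distribution on some open
  neighbourhood of \<open>p\<close>; it is smooth if the representative is smooth on a possibly smaller
  neighbourhood.\<close>

definition L2_CR_germs_smooth ::
    "('m::topological_space, 'n::finite) chart set \<Rightarrow> ('m set \<Rightarrow> 'm vfield set) \<Rightarrow> bool" where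
  "L2_CR_germs_smooth A Z \<longleftrightarrow>
     (\<forall>p U u. open U \<and> p \<in> U \<and> CR_distribution A Z U u \<and> locally_L2 A U u \<longrightarrow>
        (\<exists>V. open V \<and> p \<in> V \<and> V \<subseteq> U \<and> smooth_mdist A V u))"

end

theory Submission
  imports Defs "HOL-Combinatorics.Permutations" "HOL-Real_Asymp.Real_Asymp"
begin

text \<open>Suppose \<open>\<bar>f\<bar>\<close> attains its supremum over \<open>\<Omega>\<close> at \<open>p\<close>, and let \<open>c = f p \<noteq> 0\<close>. Then \<open>w = 1 - f/c\<close> has
  nonnegative real part, so \<open>w\<^sup>i\<close> is bounded. It is the bounded pointwise limit of the CR functions
  \<open>(w + \<epsilon>)\<^sup>i\<close> along a sequence of \<open>\<epsilon> > 0\<close>, hence an \<open>L\<^sup>2\<close> CR distribution, and so it agrees near each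
  point of \<open>{f = c}\<close> with a smooth function, pointwise where \<open>w \<noteq> 0\<close>. If \<open>f\<close> were not constant near
  such a point, then \<open>\<bar>w\<bar>\<close> would take all small positive values there, and \<open>w\<^sup>i\<close>, whose argument is
  \<open>ln \<bar>w\<bar>\<close>, would oscillate. Hence \<open>{f = c}\<close> is open and closed in \<open>\<Omega>\<close>.\<close>

section \<open>Smooth functions and bump functions\<close>

text \<open>No rank or integrability condition is assumed on \<open>Z\<close>, so the maximum is not
  propagated along curves or discs; \<open>f\<close> is used only through functions of
  \<open>f\<close>, and the regularity hypothesis speaks about weak solutions. What is wanted is a
  function of one complex variable that is holomorphic and bounded in the open right half-plane and
  has no limit at the boundary point 0. With z = r e^(i t), the power z^i equals exp(-t) e^(i ln r):
  since |t| <= pi/2, its modulus lies between exp(-pi/2) and exp(pi/2), while its phase turns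
  infinitely often as r tends to 0. The shift keeps the values away from 0, the only point of the
  closed half-plane on the branch cut of \<open>Ln\<close>; there the chain rule holds classically,
  and the equation survives the limit once the derivatives sit on the test function. The set where w
  = 0 may have positive measure, so the limit is compared with its smooth representative only on the
  open set where w is nonzero. Distributions are compatible families over all charts, so even a
  bounded function has to be shown to be one by the change of variables formula.\<close>

lemma frechet_derivative_eqI:
  "(f has_derivative f') (at x) \<Longrightarrow> frechet_derivative f (at x) = f'"
  by (rule frechet_derivative_at[symmetric])

lemma has_derivative_transform_open:
  assumes "open W" "x \<in> W" "\<And>y. y \<in> W \<Longrightarrow> f y = g y"
  shows "(f has_derivative D) (at x) \<longleftrightarrow> (g has_derivative D) (at x)"
  using has_derivative_transform_within_open[OF _ assms(1,2)] assms(3) by metis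

text \<open>Differentiability is not assumed: \<open>frechet_derivative\<close> is a Hilbert choice,
  so it agrees as soon as the two functions have the same candidate derivatives, possibly
  none.\<close>

lemma frechet_derivative_cong_open:
  assumes "open W" "x \<in> W" "\<And>y. y \<in> W \<Longrightarrow> f y = g y"
  shows "frechet_derivative f (at x) = frechet_derivative g (at x)"
proof -
  have "(f has_derivative D) (at x) \<longleftrightarrow> (g has_derivative D) (at x)" for D
    by (rule has_derivative_transform_open[OF assms(1,2)]) (rule assms(3))
  then show ?thesis
    unfolding frechet_derivative_def by simp
qed

lemma differentiable_cong_open:
  assumes "open W" "x \<in> W" "\<And>y. y \<in> W \<Longrightarrow> f y = g y"
  shows "f differentiable (at x) \<longleftrightarrow> g differentiable (at x)"
proof -
  have "(f has_derivative D) (at x) \<longleftrightarrow> (g has_derivative D) (at x)" for D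
    by (rule has_derivative_transform_open[OF assms(1,2)]) (rule assms(3))
  then show ?thesis
    unfolding differentiable_def by simp
qed

lemma Ck_on_cong:
  assumes "open W" "\<And>y. y \<in> W \<Longrightarrow> f y = g y"
  shows "Ck_on k W f \<longleftrightarrow> Ck_on k W g"
  using assms(2)
proof (induction k arbitrary: f g)
  case 0
  then show ?case by (auto cong: continuous_on_cong)
next
  case (Suc k)
  have "Ck_on k W (\<lambda>x. frechet_derivative f (at x) v) \<longleftrightarrow>
      Ck_on k W (\<lambda>x. frechet_derivative g (at x) v)" for v
    by (rule Suc.IH) (simp add: frechet_derivative_cong_open[OF assms(1) _ Suc.prems])
  then show ?case
    using differentiable_cong_open[OF assms(1) _ Suc.prems] by auto
qed

lemma Ck_on_bounded_linear:
  assumes "bounded_linear L" "open W" "Ck_on k W f"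
  shows "Ck_on k W (\<lambda>x. L (f x))"
  using assms(3)
proof (induction k arbitrary: f)
  case 0
  then show ?case
    by (auto intro!: continuous_intros bounded_linear.continuous_on[OF assms(1)])
next
  case (Suc k)
  have der: "((\<lambda>x. L (f x)) has_derivative (\<lambda>v. L (frechet_derivative f (at x) v))) (at x)"
    if "x \<in> W" for x
    using Suc.prems that
    by (auto intro!: bounded_linear.has_derivative[OF assms(1)] simp: frechet_derivative_works)
  have "Ck_on k W (\<lambda>x. frechet_derivative (\<lambda>x. L (f x)) (at x) v)" for v
  proof (subst Ck_on_cong[OF assms(2)])
    show "frechet_derivative (\<lambda>x. L (f x)) (at x) v = L (frechet_derivative f (at x) v)"
      if "x \<in> W" for x
      using frechet_derivative_eqI[OF der[OF that]] by simp
    show "Ck_on k W (\<lambda>x. L (frechet_derivative f (at x) v))"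
      using Suc.prems by (intro Suc.IH) auto
  qed
  then show ?case
    using der by (auto simp: differentiable_def)
qed

lemma Ck_on_subset: "Ck_on k W f \<Longrightarrow> V \<subseteq> W \<Longrightarrow> Ck_on k V f"
  by (induction k arbitrary: f) (auto intro: continuous_on_subset)

lemma smooth_on_subset: "smooth_on W f \<Longrightarrow> V \<subseteq> W \<Longrightarrow> smooth_on V f"
  unfolding smooth_on_def using Ck_on_subset by blast

lemma smooth_on_Suc0: "smooth_on W f \<Longrightarrow> Ck_on (Suc 0) W f"
  unfolding smooth_on_def by blast

lemma Ck1_has_derivative:
  "Ck_on (Suc 0) W f \<Longrightarrow> x \<in> W \<Longrightarrow> (f has_derivative frechet_derivative f (at x)) (at x)"
  by (simp add: frechet_derivative_works)

lemma Ck1_continuous_on: "Ck_on (Suc 0) W f \<Longrightarrow> continuous_on W f"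
  by (auto intro!: continuous_at_imp_continuous_on differentiable_imp_continuous_within)

lemma smooth_on_continuous_on: "smooth_on W f \<Longrightarrow> continuous_on W f"
  using Ck1_continuous_on smooth_on_Suc0 by blast

lemma Ck1_onI:
  assumes "open W" "\<And>x. x \<in> W \<Longrightarrow> (f has_derivative D x) (at x)"
    "\<And>v. continuous_on W (\<lambda>x. D x v)"
  shows "Ck_on (Suc 0) W f"
proof -
  have "continuous_on W (\<lambda>x. frechet_derivative f (at x) v)" for v
    using assms(3)[of v]
    by (rule continuous_on_eq) (simp add: frechet_derivative_eqI[OF assms(2)])
  then show ?thesis
    using assms(2) by (auto simp: differentiable_def)
qed

text \<open>The powers in the denominator make the family closed under differentiation: the
  derivative of each member is a combination of the members with index \<open>m + 2\<close> and
  \<open>m + 1\<close>.\<close>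

definition flat :: "nat \<Rightarrow> real \<Rightarrow> real" where
  "flat m x = (if x > 0 then exp (- (1 / x)) / x ^ m else 0)"

lemma flat_tendsto_0: "((\<lambda>x. exp (- (1 / x)) / x ^ m) \<longlongrightarrow> (0::real)) (at_right 0)"
proof -
  have "((\<lambda>x. x ^ m / exp x) \<longlongrightarrow> (0::real)) at_top"
    by (rule tendsto_power_div_exp_0)
  then have "((\<lambda>x. (inverse x) ^ m / exp (inverse x)) \<longlongrightarrow> (0::real)) (at_right 0)"
    by (rule filterlim_compose) (rule filterlim_inverse_at_top_right)
  then show ?thesis
    by (simp add: exp_minus field_simps)
qed

lemma flat_has_real_derivative:
  "(flat m has_real_derivative (flat (m + 2) x - m * flat (m + 1) x)) (at x)"
proof (cases x "0::real" rule: linorder_cases)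
  case less
  have "(flat m has_real_derivative 0) (at x)"
    using less by (subst DERIV_cong_ev[OF refl _ refl, of _ "\<lambda>_. 0"])
      (auto simp: flat_def intro!: eventually_mono[OF eventually_nhds_in_open[of "{..<0}"]])
  then show ?thesis using less by (simp add: flat_def)
next
  case greater
  have "((\<lambda>x. exp (- (1 / x)) / x ^ m) has_real_derivative (flat (m + 2) x - m * flat (m + 1) x)) (at x)"
    using greater
    by (auto intro!: derivative_eq_intros simp: flat_def field_simps power2_eq_square)
      (cases m; simp add: field_simps)
  then show ?thesis
    using greater
    by (subst DERIV_cong_ev[OF refl _ refl])
      (auto simp: flat_def intro!: eventually_mono[OF eventually_nhds_in_open[of "{0<..}"]])
next
  case equal
  have "((\<lambda>y. (flat m y - flat m 0) / (y - 0)) \<longlongrightarrow> 0) (at 0)"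
  proof (rule filterlim_split_at)
    show "((\<lambda>y. (flat m y - flat m 0) / (y - 0)) \<longlongrightarrow> 0) (at_left 0)"
      by (rule tendsto_eventually)
        (auto simp: flat_def eventually_at_filter)
    \<comment> \<open>For positive \<open>y\<close> this difference quotient is
      \<open>flat (Suc m) y\<close>, so the same decay estimate with the next index gives the
      limit.\<close>
    show "((\<lambda>y. (flat m y - flat m 0) / (y - 0)) \<longlongrightarrow> 0) (at_right 0)"
      by (rule Lim_transform_eventually[OF flat_tendsto_0[of "Suc m"]])
        (auto simp: flat_def eventually_at_filter)
  qed
  then show ?thesis
    unfolding has_field_derivative_iff using equal by (simp add: flat_def)
qed

text \<open>This class is closed under directional derivatives, so that all of its members are smooth.\<close>

inductive bump_class :: "'a::euclidean_space \<Rightarrow> real \<Rightarrow> ('a \<Rightarrow> real) \<Rightarrow> bool" for x0 r where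
  const: "bump_class x0 r (\<lambda>x. c)"
| lin: "bump_class x0 r (\<lambda>x. (x - x0) \<bullet> v)"
| flat: "bump_class x0 r (\<lambda>x. flat m (r\<^sup>2 - (x - x0) \<bullet> (x - x0)))"
| add: "bump_class x0 r f \<Longrightarrow> bump_class x0 r g \<Longrightarrow> bump_class x0 r (\<lambda>x. f x + g x)"
| mult: "bump_class x0 r f \<Longrightarrow> bump_class x0 r g \<Longrightarrow> bump_class x0 r (\<lambda>x. f x * g x)"

lemma bump_class_derivative:
  assumes "bump_class x0 r f"
  shows "\<exists>D. (\<forall>x. (f has_derivative D x) (at x)) \<and> (\<forall>v. bump_class x0 r (\<lambda>x. D x v))"
  using assms
proof induction
  case (const c)
  show ?case
    by (rule exI[of _ "\<lambda>x v. 0"]) (auto intro: bump_class.const)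
next
  case (lin w)
  show ?case
    by (rule exI[of _ "\<lambda>x v. v \<bullet> w"]) (auto intro!: bump_class.const derivative_eq_intros)
next
  case (flat m)
  let ?q = "\<lambda>x. r\<^sup>2 - (x - x0) \<bullet> (x - x0)"
  \<comment> \<open>The factor -2 sits inside the inner product and the minus sign in a constant, so
    that \<open>?D x v\<close> is literally built from the constructors of
    \<open>bump_class\<close>.\<close>
  let ?D = "\<lambda>x v. (flat (m + 2) (?q x) + (- real m) * flat (m + 1) (?q x)) * ((x - x0) \<bullet> ((-2) *\<^sub>R v))"
  have "((\<lambda>x. flat m (?q x)) has_derivative ?D x) (at x)" for x
  proof -
    have q: "(?q has_derivative (\<lambda>v. (x - x0) \<bullet> ((-2) *\<^sub>R v))) (at x)"
      by (auto intro!: derivative_eq_intros simp: inner_commute)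
    show ?thesis
      using has_derivative_compose[OF q flat_has_real_derivative[unfolded has_field_derivative_def]]
      by (simp add: algebra_simps)
  qed
  moreover have "bump_class x0 r (\<lambda>x. ?D x v)" for v
    by (intro bump_class.intros)
  ultimately show ?case by (intro exI[of _ ?D]) blast
next
  case (add f g)
  then obtain D E where D: "\<And>x. (f has_derivative D x) (at x)" "\<And>v. bump_class x0 r (\<lambda>x. D x v)"
    and E: "\<And>x. (g has_derivative E x) (at x)" "\<And>v. bump_class x0 r (\<lambda>x. E x v)" by blast
  show ?case
    by (rule exI[of _ "\<lambda>x v. D x v + E x v"])
      (intro conjI allI has_derivative_add D E bump_class.add)
next
  case (mult f g)
  then obtain D E where D: "\<And>x. (f has_derivative D x) (at x)" "\<And>v. bump_class x0 r (\<lambda>x. D x v)"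
    and E: "\<And>x. (g has_derivative E x) (at x)" "\<And>v. bump_class x0 r (\<lambda>x. E x v)" by blast
  show ?case
    by (rule exI[of _ "\<lambda>x v. f x * E x v + D x v * g x"])
      (intro conjI allI has_derivative_mult D E bump_class.add bump_class.mult mult.hyps)
qed

lemma bump_class_smooth:
  assumes "bump_class x0 r f"
  shows "smooth_on UNIV f"
  unfolding smooth_on_def
proof
  show "Ck_on k UNIV f" for k
    using assms
  proof (induction k arbitrary: f)
    case 0
    then obtain D where "\<And>x. (f has_derivative D x) (at x)"
      using bump_class_derivative by blast
    then show ?case
      by (auto intro!: continuous_at_imp_continuous_on has_derivative_continuous)
  next
    case (Suc k)
    then obtain D where D: "\<And>x. (f has_derivative D x) (at x)" "\<And>v. bump_class x0 r (\<lambda>x. D x v)"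
      using bump_class_derivative by blast
    then show ?case
      using Suc.IH by (auto simp: differentiable_def frechet_derivative_eqI[OF D(1)])
  qed
qed

lemma bump_exists:
  fixes x0 :: "real^'n::finite"
  assumes "r > 0"
  obtains b :: "real^'n \<Rightarrow> real" where "continuous_on UNIV b" "\<And>x. b x \<ge> 0" "b x0 > 0"
    "\<And>x. x \<notin> cball x0 r \<Longrightarrow> b x = 0"
    "smooth_on UNIV (\<lambda>x. complex_of_real (b x))"
    "tsupp (\<lambda>x. complex_of_real (b x)) \<subseteq> cball x0 r"
    "compact (tsupp (\<lambda>x. complex_of_real (b x)))"
proof
  let ?b = "\<lambda>x. flat 0 (r\<^sup>2 - (x - x0) \<bullet> (x - x0))"
  have sm: "smooth_on UNIV ?b"
    by (rule bump_class_smooth) (rule bump_class.flat)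
  show "continuous_on UNIV ?b"
    by (rule smooth_on_continuous_on[OF sm])
  show "smooth_on UNIV (\<lambda>x. complex_of_real (?b x))"
    using sm Ck_on_bounded_linear[OF bounded_linear_of_real] unfolding smooth_on_def by blast
  show "?b x \<ge> 0" for x by (simp add: flat_def)
  show "?b x0 > 0" using assms by (simp add: flat_def)
  show z: "?b x = 0" if "x \<notin> cball x0 r" for x
  proof -
    have "r < norm (x - x0)" using that by (simp add: dist_norm norm_minus_commute)
    then have "r\<^sup>2 < (norm (x - x0))\<^sup>2" using assms by (intro power_strict_mono) auto
    then show ?thesis by (simp add: flat_def power2_norm_eq_inner)
  qed
  show t: "tsupp (\<lambda>x. complex_of_real (?b x)) \<subseteq> cball x0 r"
    unfolding tsupp_def
  proof (rule closure_minimal)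
    show "{x. complex_of_real (?b x) \<noteq> 0} \<subseteq> cball x0 r"
    proof
      fix x assume "x \<in> {x. complex_of_real (?b x) \<noteq> 0}"
      then have "?b x \<noteq> 0" by simp
      then show "x \<in> cball x0 r" using z by blast
    qed
  qed simp
  then show "compact (tsupp (\<lambda>x. complex_of_real (?b x)))"
    unfolding tsupp_def compact_eq_bounded_closed using bounded_subset[OF bounded_cball] by blast
qed

section \<open>Supports of test functions and the fundamental lemma of the calculus of
  variations\<close>

lemma tsupp_notin: "x \<notin> tsupp \<phi> \<Longrightarrow> \<phi> x = 0"
  using closure_subset[of "{x. \<phi> x \<noteq> 0}"] unfolding tsupp_def by blast

lemma test_functions_mono: "V \<subseteq> W \<Longrightarrow> test_functions V \<subseteq> test_functions W"
  unfolding test_functions_def by blast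

text \<open>If \<open>g x0\<close> were nonzero, multiplication by \<open>cnj (g x0)\<close> would
  give \<open>g\<close> a positive real part near \<open>x0\<close>, and integrating it against a
  nonnegative bump supported there could not give 0.\<close>

lemma continuous_orthogonal_test_functions:
  fixes g :: "real^'n::finite \<Rightarrow> complex"
  assumes W: "open W" and g: "continuous_on W g"
    and int0: "\<And>\<phi>. \<phi> \<in> test_functions W \<Longrightarrow> (\<integral>x. indicator W x *\<^sub>R (g x * \<phi> x) \<partial>lborel) = 0"
    and x0: "x0 \<in> W"
  shows "g x0 = 0"
proof (rule ccontr)
  assume nz: "g x0 \<noteq> 0"
  define k where "k x = Re (g x * cnj (g x0))" for x
  have k: "continuous_on W k"
    unfolding k_def by (intro continuous_intros g)
  have k0: "k x0 > 0" using nz by (simp add: k_def complex_mult_cnj complex_neq_0)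
  have "open (k -` {0<..} \<inter> W)"
    using continuous_on_open_vimage[OF W] k open_greaterThan by blast
  moreover have "x0 \<in> k -` {0<..} \<inter> W" using k0 x0 by simp
  ultimately obtain r where r: "r > 0" "cball x0 r \<subseteq> k -` {0<..} \<inter> W"
    unfolding open_contains_cball by blast
  have kpos: "k x > 0" if "x \<in> cball x0 r" for x
    using r(2) that by blast
  obtain b where b: "continuous_on UNIV b" "\<And>x. b x \<ge> 0" "b x0 > 0"
    "\<And>x. x \<notin> cball x0 r \<Longrightarrow> b x = 0"
    "smooth_on UNIV (\<lambda>x. complex_of_real (b x))"
    "tsupp (\<lambda>x. complex_of_real (b x)) \<subseteq> cball x0 r"
    "compact (tsupp (\<lambda>x. complex_of_real (b x)))"
    by (rule bump_exists[OF r(1), of x0]) blast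
  let ?K = "cball x0 r"
  have 0: "(\<integral>x. indicator W x *\<^sub>R (g x * b x) \<partial>lborel) = 0"
    using b(5-7) r(2) by (intro int0) (simp add: test_functions_def, blast)
  have eq: "indicator W x *\<^sub>R (g x * b x) = indicator ?K x *\<^sub>R (g x * b x)" for x
    using b(4)[of x] r(2) by (cases "x \<in> ?K") (auto simp: indicator_def)
  have intg: "integrable lborel (\<lambda>x. indicator ?K x *\<^sub>R (g x * b x))"
  proof (rule borel_integrable_compact)
    have "?K \<subseteq> W" using r(2) by blast
    then show "continuous_on ?K (\<lambda>x. g x * complex_of_real (b x))"
      using continuous_on_subset[OF g] continuous_on_subset[OF b(1) subset_UNIV]
      by (intro continuous_intros)
  qed simp
  define F where "F x = Re ((indicator ?K x *\<^sub>R (g x * b x)) * cnj (g x0))" for x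
  have F: "integrable lborel F" "integral\<^sup>L lborel F = 0"
    unfolding F_def using 0 intg unfolding eq
    by (simp_all only: integral_Re integrable_Re integrable_mult_left integral_mult_left_zero
        mult_zero_left zero_complex.sel)
  have Feq: "F x = indicator ?K x * (k x * b x)" for x
    by (auto simp: F_def k_def indicator_def algebra_simps)
  have Fnn: "F x \<ge> 0" for x
  proof (cases "x \<in> ?K")
    case True
    then show ?thesis
      using mult_nonneg_nonneg[OF less_imp_le[OF kpos[OF True]] b(2)[of x]] by (simp add: Feq)
  qed (simp add: Feq)
  have "AE x in lborel. F x = 0"
    using integral_nonneg_eq_0_iff_AE[OF F(1)] Fnn F(2) by blast
  then have ae: "AE x in lborel. \<not> (x \<in> ball x0 r \<and> b x \<noteq> 0)"
  proof eventually_elim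
    case (elim x)
    show ?case
    proof
      assume x: "x \<in> ball x0 r \<and> b x \<noteq> 0"
      then have "k x > 0" using kpos[of x] by simp
      then show False using elim x by (auto simp: Feq indicator_def)
    qed
  qed
  \<comment> \<open>Of \<open>b\<close> only \<open>b x0 > 0\<close> is at hand, so continuity
    supplies a smaller ball on which \<open>b\<close> does not vanish; by \<open>ae\<close> that
    ball would be a null set.\<close>
  have "open (ball x0 r \<inter> b -` (-{0}))"
    by (intro open_Int open_ball open_vimage b(1) open_Compl closed_singleton)
  moreover have "x0 \<in> ball x0 r \<inter> b -` (-{0})" using r b(3) by simp
  ultimately obtain s where s: "s > 0" "ball x0 s \<subseteq> ball x0 r \<inter> b -` (-{0})"
    unfolding open_contains_ball by blast
  have "AE x in lborel. x \<notin> ball x0 s"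
    using ae by eventually_elim (use s(2) in auto)
  then have "emeasure lborel (ball x0 s) = 0"
    by (subst (asm) AE_iff_null_sets[symmetric]) auto
  then show False
    using s(1) unit_ball_vol_pos[of "real (DIM(real^'n))"] by (simp add: emeasure_ball)
qed

section \<open>Integration by parts\<close>

lemma integrable_continuous_compact_support:
  fixes f :: "'a::euclidean_space \<Rightarrow> 'b::{banach, second_countable_topology}"
  assumes "continuous_on UNIV f" "compact K" "\<And>x. x \<notin> K \<Longrightarrow> f x = 0"
  shows "integrable lborel f"
proof -
  have "integrable lborel (\<lambda>x. indicator K x *\<^sub>R f x)"
    by (rule borel_integrable_compact[OF assms(2) continuous_on_subset[OF assms(1) subset_UNIV]])
  also have "(\<lambda>x. indicator K x *\<^sub>R f x) = f"
    using assms(3) by (auto simp: indicator_def)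
  finally show ?thesis .
qed

lemma continuous_compact_support_bounded:
  fixes f :: "'a::topological_space \<Rightarrow> 'b::real_normed_vector"
  assumes "continuous_on UNIV f" "compact K" "\<And>x. x \<notin> K \<Longrightarrow> f x = 0"
  obtains B where "B \<ge> 0" "\<And>x. norm (f x) \<le> B"
proof -
  have "bounded (f ` K)"
    by (intro compact_imp_bounded compact_continuous_image assms(2)
        continuous_on_subset[OF assms(1) subset_UNIV])
  then obtain B where B: "\<And>x. x \<in> K \<Longrightarrow> norm (f x) \<le> B"
    unfolding bounded_iff by blast
  have "norm (f x) \<le> max B 0" for x
    using B[of x] assms(3)[of x] by (cases "x \<in> K") auto
  then show ?thesis by (intro that[of "max B 0"]) auto
qed

lemma has_derivative_0_outside:
  assumes "closed K" "\<And>x. x \<notin> K \<Longrightarrow> f x = 0" "x \<notin> K"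
  shows "(f has_derivative (\<lambda>_. 0)) (at x)"
  by (rule has_derivative_transform_within_open[of "\<lambda>_. 0" _ _ _ "-K"]) (use assms in auto)

text \<open>Lebesgue measure is translation invariant, so every difference quotient of
  \<open>f\<close> in direction \<open>v\<close> has integral 0; dominated convergence carries this
  over to the derivative. This replaces iterated integration along coordinate lines.\<close>

lemma integral_directional_derivative_eq_0:
  fixes f :: "'a::euclidean_space \<Rightarrow> complex"
  assumes f: "Ck_on (Suc 0) UNIV f" and K: "compact K" and f0: "\<And>x. x \<notin> K \<Longrightarrow> f x = 0"
  shows "(\<integral>x. frechet_derivative f (at x) v \<partial>lborel) = 0"
proof -
  define D where "D x = frechet_derivative f (at x) v" for x
  have contf: "continuous_on UNIV f" by (rule Ck1_continuous_on[OF f])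
  have contD: "continuous_on UNIV D" using f by (simp add: D_def)
  have D0: "D x = 0" if "x \<notin> K" for x
    using frechet_derivative_eqI[OF has_derivative_0_outside[OF compact_imp_closed[OF K] f0 that]]
    by (simp add: D_def)
  obtain B where B: "B \<ge> 0" "\<And>x. norm (D x) \<le> B"
    using continuous_compact_support_bounded[OF contD K D0] by blast
  obtain R where R: "\<And>x. x \<in> K \<Longrightarrow> norm x \<le> R"
    using compact_imp_bounded[OF K] unfolding bounded_iff by blast
  define t where "t n = inverse (real (Suc n))" for n
  have t: "t n > 0" "t n \<le> 1" for n
    by (auto simp: t_def field_simps)
  have t0: "t \<longlonglongrightarrow> 0" unfolding t_def by (rule LIMSEQ_inverse_real_of_nat)
  define s where "s n x = inverse (t n) *\<^sub>R (f (t n *\<^sub>R v + x) - f x)" for n x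
  have line: "((\<lambda>\<tau>. f (\<tau> *\<^sub>R v + x)) has_derivative (\<lambda>h. h *\<^sub>R D (\<tau> *\<^sub>R v + x))) (at \<tau>)" for x \<tau>
  proof -
    have "(f has_derivative frechet_derivative f (at (\<tau> *\<^sub>R v + x))) (at (\<tau> *\<^sub>R v + x))"
      by (rule Ck1_has_derivative[OF f UNIV_I])
    moreover have "((\<lambda>\<tau>. \<tau> *\<^sub>R v + x) has_derivative (\<lambda>h. h *\<^sub>R v)) (at \<tau>)"
      by (auto intro!: derivative_eq_intros)
    ultimately have "((\<lambda>\<tau>. f (\<tau> *\<^sub>R v + x)) has_derivative
        (\<lambda>h. frechet_derivative f (at (\<tau> *\<^sub>R v + x)) (h *\<^sub>R v))) (at \<tau>)"
      by (rule has_derivative_compose[rotated])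
    moreover have "linear (frechet_derivative f (at (\<tau> *\<^sub>R v + x)))"
      using f by (auto intro: linear_frechet_derivative)
    ultimately show ?thesis
      by (simp add: D_def linear_scale)
  qed
  \<comment> \<open>Inside the ball the bound is the mean value inequality along the segment.
    Outside, since \<open>t n \<le> 1\<close>, both \<open>x\<close> and its translate have norm
    greater than \<open>R\<close> and therefore miss \<open>K\<close>, so the quotient is 0.\<close>
  have s_bound: "norm (s n x) \<le> B * indicator (cball 0 (R + norm v)) x" for n x
  proof (cases "x \<in> cball 0 (R + norm v)")
    case True
    have "norm (f (t n *\<^sub>R v + x) - f (0 *\<^sub>R v + x)) \<le> B * norm (t n - 0)"
    proof (rule differentiable_bound[OF convex_UNIV])
      show "((\<lambda>\<tau>. f (\<tau> *\<^sub>R v + x)) has_derivative (\<lambda>h. h *\<^sub>R D (\<tau> *\<^sub>R v + x))) (at \<tau> within UNIV)" for \<tau>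
        using line by simp
      show "onorm (\<lambda>h. h *\<^sub>R D (\<tau> *\<^sub>R v + x)) \<le> B" for \<tau>
      proof (rule onorm_le)
        show "norm (h *\<^sub>R D (\<tau> *\<^sub>R v + x)) \<le> B * norm h" for h
          using mult_right_mono[OF B(2)[of "\<tau> *\<^sub>R v + x"] abs_ge_zero[of h]] by (simp add: mult.commute)
      qed
    qed auto
    then have "norm (f (t n *\<^sub>R v + x) - f x) / t n \<le> B"
      using t[of n] by (simp add: pos_divide_le_eq)
    moreover have "norm (s n x) = norm (f (t n *\<^sub>R v + x) - f x) / t n"
      unfolding s_def norm_scaleR using t[of n] by (simp add: divide_inverse_commute)
    ultimately show ?thesis using True by simp
  next
    case False
    then have "norm x > R + norm v" by simp
    moreover have "norm (t n *\<^sub>R v) \<le> norm v"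
      using t[of n] by (simp add: mult_left_le_one_le)
    moreover have "norm x \<le> norm (t n *\<^sub>R v + x) + norm (t n *\<^sub>R v)"
      using norm_triangle_ineq4[of "t n *\<^sub>R v + x" "t n *\<^sub>R v"] by simp
    ultimately have "x \<notin> K" "t n *\<^sub>R v + x \<notin> K"
      using R[of x] R[of "t n *\<^sub>R v + x"] norm_ge_zero[of v] by linarith+
    then show ?thesis using False by (simp add: s_def f0)
  qed
  have s_lim: "(\<lambda>n. s n x) \<longlonglongrightarrow> D x" for x
  proof -
    have "((\<lambda>h. norm (f (h *\<^sub>R v + x) - f x - h *\<^sub>R D x) / norm h) \<longlongrightarrow> 0) (at 0)"
      using line[of x 0] unfolding has_derivative_at by simp
    moreover have "filterlim t (at 0) sequentially"
      using t t0 by (auto simp: filterlim_at less_imp_neq[symmetric] intro!: always_eventually)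
    ultimately have "(\<lambda>n. norm (f (t n *\<^sub>R v + x) - f x - t n *\<^sub>R D x) / norm (t n)) \<longlonglongrightarrow> 0"
      by (rule filterlim_compose)
    moreover have "norm (f (t n *\<^sub>R v + x) - f x - t n *\<^sub>R D x) / norm (t n) = norm (s n x - D x)" for n
    proof -
      have "s n x - D x = inverse (t n) *\<^sub>R (f (t n *\<^sub>R v + x) - f x - t n *\<^sub>R D x)"
        using t[of n] by (simp add: s_def scaleR_diff_right)
      then show ?thesis using t[of n] by (simp add: divide_inverse_commute)
    qed
    ultimately show ?thesis
      by (simp add: LIM_zero_iff tendsto_norm_zero_iff)
  qed
  have contfs: "continuous_on UNIV (\<lambda>x. f (t n *\<^sub>R v + x))" for n
    by (intro continuous_on_compose2[OF contf] continuous_intros) auto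
  have intf: "integrable lborel f"
    by (rule integrable_continuous_compact_support[OF contf K f0])
  have shift: "integrable lborel (\<lambda>x. f (c + x))" "(\<integral>x. f (c + x) \<partial>lborel) = integral\<^sup>L lborel f" for c
  proof -
    have [measurable]: "f \<in> borel_measurable borel"
      by (rule borel_measurable_continuous_onI[OF contf])
    have "integrable (distr lborel borel ((+) c)) f" by (simp add: lborel_distr_plus intf)
    then show "integrable lborel (\<lambda>x. f (c + x))" by (subst (asm) integrable_distr_eq) auto
    have "integral\<^sup>L (distr lborel borel ((+) c)) f = (\<integral>x. f (c + x) \<partial>lborel)"
      by (subst integral_distr) auto
    then show "(\<integral>x. f (c + x) \<partial>lborel) = integral\<^sup>L lborel f" by (simp add: lborel_distr_plus)
  qed
  have int_s: "integral\<^sup>L lborel (s n) = 0" for n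
    unfolding s_def using shift[of "t n *\<^sub>R v"] intf by simp
  have "(\<lambda>n. integral\<^sup>L lborel (s n)) \<longlonglongrightarrow> integral\<^sup>L lborel D"
  proof (rule integral_dominated_convergence[where w = "\<lambda>x. B * indicator (cball 0 (R + norm v)) x"])
    show "D \<in> borel_measurable lborel"
      using borel_measurable_continuous_onI[OF contD] by simp
    show "s n \<in> borel_measurable lborel" for n
      unfolding s_def
      using borel_measurable_continuous_onI[OF contfs] borel_measurable_continuous_onI[OF contf] by simp
    show "integrable lborel (\<lambda>x. B * indicator (cball (0::'a) (R + norm v)) x)"
      using borel_integrable_compact[of "cball (0::'a) (R + norm v)" "\<lambda>_. B"] by (simp add: mult.commute)
  qed (use s_bound s_lim in auto)
  then show ?thesis
    unfolding int_s D_def using LIMSEQ_unique tendsto_const by blast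
qed

lemma Ck1_mult:
  fixes f g :: "'a::euclidean_space \<Rightarrow> 'b::real_normed_algebra"
  assumes W: "open W" and f: "Ck_on (Suc 0) W f" and g: "Ck_on (Suc 0) W g"
  shows "Ck_on (Suc 0) W (\<lambda>x. f x * g x)"
    and "x \<in> W \<Longrightarrow> frechet_derivative (\<lambda>x. f x * g x) (at x) v =
      f x * frechet_derivative g (at x) v + frechet_derivative f (at x) v * g x"
proof -
  have der: "((\<lambda>x. f x * g x) has_derivative
      (\<lambda>v. f x * frechet_derivative g (at x) v + frechet_derivative f (at x) v * g x)) (at x)"
    if "x \<in> W" for x
    by (rule has_derivative_mult[OF Ck1_has_derivative[OF f that] Ck1_has_derivative[OF g that]])
  show "Ck_on (Suc 0) W (\<lambda>x. f x * g x)"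
  proof (rule Ck1_onI[OF W der])
    show "continuous_on W (\<lambda>x. f x * frechet_derivative g (at x) v + frechet_derivative f (at x) v * g x)" for v
      using f g by (intro continuous_intros Ck1_continuous_on[OF f] Ck1_continuous_on[OF g]) auto
  qed
  show "x \<in> W \<Longrightarrow> frechet_derivative (\<lambda>x. f x * g x) (at x) v =
      f x * frechet_derivative g (at x) v + frechet_derivative f (at x) v * g x"
    using frechet_derivative_eqI[OF der] by simp
qed

text \<open>\<open>W\<close> and the complement of \<open>K\<close> are open and cover the space,
  and on the second set the function and its derivative vanish.\<close>

lemma Ck1_extend_zero:
  assumes W: "open W" and f: "Ck_on (Suc 0) W f" and K: "compact K" "K \<subseteq> W"
    and f0: "\<And>x. x \<notin> K \<Longrightarrow> f x = 0"
  shows "Ck_on (Suc 0) UNIV f"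
proof (rule Ck1_onI[OF open_UNIV])
  have clK: "closed K" by (rule compact_imp_closed[OF K(1)])
  have zero: "(f has_derivative (\<lambda>_. 0)) (at x)" if "x \<notin> K" for x
    by (rule has_derivative_0_outside[OF clK f0 that])
  show "(f has_derivative frechet_derivative f (at x)) (at x)" for x
  proof (cases "x \<in> W")
    case False
    then have "x \<notin> K" using K by blast
    then show ?thesis using zero frechet_derivative_eqI[OF zero] by simp
  qed (rule Ck1_has_derivative[OF f])
  show "continuous_on UNIV (\<lambda>x. frechet_derivative f (at x) v)" for v
  proof -
    have "continuous_on (- K) (\<lambda>x. frechet_derivative f (at x) v)"
      by (rule continuous_on_eq[OF continuous_on_const[of _ 0]])
        (simp add: frechet_derivative_eqI[OF zero])
    then have "continuous_on (W \<union> - K) (\<lambda>x. frechet_derivative f (at x) v)"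
      using f clK by (intro continuous_on_open_Un W) auto
    moreover have "W \<union> - K = UNIV" using K by blast
    ultimately show ?thesis by simp
  qed
qed

text \<open>Coefficients of a vector field are regular only on the image of a chart and arbitrary
  outside it; the support of the test function makes the product regular on the whole space, so that
  integration by parts applies.\<close>

lemma Ck1_mult_test_function:
  assumes W: "open W" and a: "Ck_on (Suc 0) W a" and \<phi>: "\<phi> \<in> test_functions W"
  shows "Ck_on (Suc 0) W (\<lambda>x. a x * \<phi> x)" and "Ck_on (Suc 0) UNIV (\<lambda>x. a x * \<phi> x)"
proof -
  have "smooth_on UNIV \<phi>" using \<phi> by (simp add: test_functions_def)
  then have "Ck_on (Suc 0) W \<phi>"
    by (rule smooth_on_Suc0[OF smooth_on_subset[OF _ subset_UNIV]])
  then show *: "Ck_on (Suc 0) W (\<lambda>x. a x * \<phi> x)"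
    by (rule Ck1_mult(1)[OF W a])
  have "compact (tsupp \<phi>)" "tsupp \<phi> \<subseteq> W"
    using \<phi> by (simp_all add: test_functions_def)
  then show "Ck_on (Suc 0) UNIV (\<lambda>x. a x * \<phi> x)"
    by (rule Ck1_extend_zero[OF W *]) (simp add: tsupp_notin)
qed

lemma integrable_bounded_mult:
  fixes H S :: "'a \<Rightarrow> complex"
  assumes "H \<in> borel_measurable M" "\<And>x. norm (H x) \<le> B" "integrable M S"
  shows "integrable M (\<lambda>x. H x * S x)"
proof (rule Bochner_Integration.integrable_bound)
  show "integrable M (\<lambda>x. B * norm (S x))" using assms(3) by simp
  show "AE x in M. norm (H x * S x) \<le> norm (B * norm (S x))"
  proof (intro always_eventually allI)
    fix x
    have "norm (H x) * norm (S x) \<le> B * norm (S x)"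
      by (rule mult_right_mono[OF assms(2) norm_ge_zero])
    also have "\<dots> \<le> norm (B * norm (S x))" by simp
    finally show "norm (H x * S x) \<le> norm (B * norm (S x))" by (simp add: norm_mult)
  qed
qed (use assms in measurable)

text \<open>Bounded pointwise limits of classical solutions are weak solutions. The sum over
  \<open>j\<close> of the derivatives of \<open>k n * a j * \<phi>\<close> has integral 0; by the
  product rule it equals \<open>k n\<close> times the sum of the derivatives of
  \<open>a j * \<phi>\<close>, plus \<open>\<phi>\<close> times the expression annihilated by
  hypothesis. What remains contains no derivative of \<open>k n\<close>, and dominated convergence
  replaces \<open>k n\<close> by \<open>h\<close>.\<close>

lemma limit_annihilated_weakly:
  fixes a :: "'n::finite \<Rightarrow> real^'n \<Rightarrow> complex" and k :: "nat \<Rightarrow> real^'n \<Rightarrow> complex"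
  assumes W: "open W" and k: "\<And>n. Ck_on (Suc 0) W (k n)"
    and ann: "\<And>n x. x \<in> W \<Longrightarrow> (\<Sum>j\<in>UNIV. a j x * partial j (k n) x) = 0"
    and a: "\<And>j. Ck_on (Suc 0) W (a j)"
    and lim: "\<And>x. x \<in> W \<Longrightarrow> (\<lambda>n. k n x) \<longlonglongrightarrow> h x"
    and bound: "\<And>n x. x \<in> W \<Longrightarrow> cmod (k n x) \<le> B"
    and \<phi>: "\<phi> \<in> test_functions W"
  shows "(\<Sum>j\<in>UNIV. \<integral>x. indicator W x *\<^sub>R (h x * partial j (\<lambda>x. a j x * \<phi> x) x) \<partial>lborel) = 0"
proof -
  define K where "K = tsupp \<phi>"
  have K: "compact K" "K \<subseteq> W" and \<phi>0: "\<And>x. x \<notin> K \<Longrightarrow> \<phi> x = 0"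
    using \<phi> tsupp_notin unfolding test_functions_def K_def by blast+
  note a\<phi> = Ck1_mult_test_function(1)[OF W a \<phi>] and a\<phi>U = Ck1_mult_test_function(2)[OF W a \<phi>]
  define S where "S j x = partial j (\<lambda>x. a j x * \<phi> x) x" for j x
  have S0: "S j x = 0" if "x \<notin> K" for j x
  proof -
    have "((\<lambda>x. a j x * \<phi> x) has_derivative (\<lambda>_. 0)) (at x)"
      by (rule has_derivative_0_outside[OF compact_imp_closed[OF K(1)] _ that]) (simp add: \<phi>0)
    then show ?thesis by (simp add: S_def partial_def frechet_derivative_eqI)
  qed
  have S: "continuous_on UNIV (S j)" for j
    using a\<phi>U[of j] by (simp add: S_def[abs_def] partial_def)
  have intS: "integrable lborel (S j)" for j
    by (rule integrable_continuous_compact_support[OF S K(1) S0])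
  have meask: "(\<lambda>x. indicator W x *\<^sub>R k n x) \<in> borel_measurable lborel" for n
    using borel_measurable_continuous_on_indicator[OF borel_open[OF W] Ck1_continuous_on[OF k]]
    by simp
  \<comment> \<open>The maximum with 0 covers an empty \<open>W\<close>, for which nothing forces
    \<open>B\<close> to be nonnegative.\<close>
  have boundk: "cmod (indicator W x *\<^sub>R k n x) \<le> max B 0" for n x
    using bound[of x n] by (auto simp: indicator_def)
  have limk: "(\<lambda>n. indicator W x *\<^sub>R k n x) \<longlonglongrightarrow> indicator W x *\<^sub>R h x" for x
    using lim[of x] by (cases "x \<in> W") auto
  have measH: "(\<lambda>x. indicator W x *\<^sub>R h x) \<in> borel_measurable lborel"
    by (rule borel_measurable_LIMSEQ_metric[OF meask limk])
  have boundh: "cmod (indicator W x *\<^sub>R h x) \<le> max B 0" for x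
    by (rule LIMSEQ_le_const2[OF tendsto_norm[OF limk]]) (use boundk in blast)
  have zero: "(\<integral>x. indicator W x *\<^sub>R k n x * (\<Sum>j\<in>UNIV. S j x) \<partial>lborel) = 0" for n
  proof -
    define \<psi> where "\<psi> j x = k n x * (a j x * \<phi> x)" for j x
    have \<psi>0: "\<psi> j x = 0" if "x \<notin> K" for j x using that by (simp add: \<psi>_def \<phi>0)
    have "Ck_on (Suc 0) W (\<psi> j)" for j
      unfolding \<psi>_def by (rule Ck1_mult(1)[OF W k a\<phi>])
    then have \<psi>: "Ck_on (Suc 0) UNIV (\<psi> j)" for j
      by (rule Ck1_extend_zero[OF W _ K(1) K(2) \<psi>0])
    have p0: "partial j (\<psi> j) x = 0" if "x \<notin> K" for j x
      using frechet_derivative_eqI[OF has_derivative_0_outside[OF compact_imp_closed[OF K(1)] \<psi>0 that]]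
      by (simp add: partial_def)
    have "continuous_on UNIV (partial j (\<psi> j))" for j
      using \<psi>[of j] by (simp add: partial_def[abs_def])
    then have int: "integrable lborel (partial j (\<psi> j))" for j
      by (rule integrable_continuous_compact_support[OF _ K(1) p0])
    have "indicator W x *\<^sub>R k n x * (\<Sum>j\<in>UNIV. S j x) = (\<Sum>j\<in>UNIV. partial j (\<psi> j) x)" for x
    proof (cases "x \<in> W")
      case True
      have "partial j (\<psi> j) x = k n x * S j x + partial j (k n) x * (a j x * \<phi> x)" for j
        unfolding \<psi>_def partial_def S_def by (rule Ck1_mult(2)[OF W k a\<phi> True])
      then have "(\<Sum>j\<in>UNIV. partial j (\<psi> j) x) =
          k n x * (\<Sum>j\<in>UNIV. S j x) + (\<Sum>j\<in>UNIV. a j x * partial j (k n) x) * \<phi> x"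
        by (simp add: sum.distrib sum_distrib_left sum_distrib_right mult_ac)
      then show ?thesis using True ann[OF True] by simp
    next
      case False
      then have "x \<notin> K" using K by blast
      then show ?thesis using False p0 by simp
    qed
    then have "(\<integral>x. indicator W x *\<^sub>R k n x * (\<Sum>j\<in>UNIV. S j x) \<partial>lborel) =
        (\<Sum>j\<in>UNIV. \<integral>x. partial j (\<psi> j) x \<partial>lborel)"
      using int by simp
    also have "\<dots> = 0"
      unfolding partial_def
      by (intro sum.neutral ballI integral_directional_derivative_eq_0[OF \<psi> K(1) \<psi>0])
    finally show ?thesis .
  qed
  have "(\<lambda>n. \<integral>x. indicator W x *\<^sub>R k n x * (\<Sum>j\<in>UNIV. S j x) \<partial>lborel) \<longlonglongrightarrow>
      (\<integral>x. indicator W x *\<^sub>R h x * (\<Sum>j\<in>UNIV. S j x) \<partial>lborel)"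
  proof (rule integral_dominated_convergence[where w = "\<lambda>x. max B 0 * norm (\<Sum>j\<in>UNIV. S j x)"])
    have m: "(\<lambda>x. \<Sum>j\<in>UNIV. S j x) \<in> borel_measurable lborel" using intS by auto
    show "(\<lambda>x. indicator W x *\<^sub>R h x * (\<Sum>j\<in>UNIV. S j x)) \<in> borel_measurable lborel"
      by (rule borel_measurable_times[OF measH m])
    show "(\<lambda>x. indicator W x *\<^sub>R k n x * (\<Sum>j\<in>UNIV. S j x)) \<in> borel_measurable lborel" for n
      by (rule borel_measurable_times[OF meask m])
    show "integrable lborel (\<lambda>x. max B 0 * norm (\<Sum>j\<in>UNIV. S j x))" using intS by simp
    show "AE x in lborel. (\<lambda>n. indicator W x *\<^sub>R k n x * (\<Sum>j\<in>UNIV. S j x)) \<longlonglongrightarrow>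
        indicator W x *\<^sub>R h x * (\<Sum>j\<in>UNIV. S j x)"
      by (intro always_eventually allI tendsto_mult limk tendsto_const)
    show "AE x in lborel. norm (indicator W x *\<^sub>R k n x * (\<Sum>j\<in>UNIV. S j x)) \<le>
        max B 0 * norm (\<Sum>j\<in>UNIV. S j x)" for n
      unfolding norm_mult by (intro always_eventually allI mult_right_mono boundk norm_ge_zero)
  qed
  then have "(\<integral>x. indicator W x *\<^sub>R h x * (\<Sum>j\<in>UNIV. S j x) \<partial>lborel) = 0"
    unfolding zero using LIMSEQ_unique tendsto_const by blast
  moreover have "(\<integral>x. indicator W x *\<^sub>R h x * (\<Sum>j\<in>UNIV. S j x) \<partial>lborel) =
      (\<Sum>j\<in>UNIV. \<integral>x. indicator W x *\<^sub>R h x * S j x \<partial>lborel)"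
    unfolding sum_distrib_left
    by (rule Bochner_Integration.integral_sum) (rule integrable_bounded_mult[OF measH boundh intS])
  ultimately show ?thesis
    by (simp add: S_def)
qed

section \<open>Change of variables over an arbitrary finite index type\<close>

text \<open>The change of variables theorem of the library requires the index type to be in class
  \<open>wellorder\<close>; the formula is transported from this well-ordered copy.\<close>

typedef 'a ordered_copy = "UNIV :: 'a set"
  morphisms of_ordered_copy to_ordered_copy by blast

lemma bij_of_ordered_copy: "bij of_ordered_copy"
  by (rule o_bij[of to_ordered_copy]) (auto simp: of_ordered_copy_inverse to_ordered_copy_inverse)

instance ordered_copy :: (finite) finite
  by standard (simp add: bij_betw_finite[OF bij_of_ordered_copy])

instantiation ordered_copy :: (finite) wellorder
begin

definition ordered_copy_index :: "'a ordered_copy \<Rightarrow> nat" where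
  "ordered_copy_index = (SOME g. inj g)"

definition "x \<le> y \<longleftrightarrow> ordered_copy_index x \<le> ordered_copy_index y"
definition "x < y \<longleftrightarrow> ordered_copy_index x < ordered_copy_index y"

instance
proof
  have inj: "inj (ordered_copy_index :: 'a ordered_copy \<Rightarrow> nat)"
    unfolding ordered_copy_index_def
  proof (rule someI_ex[of inj])
    show "\<exists>g :: 'a ordered_copy \<Rightarrow> nat. inj g"
      using finite_imp_inj_to_nat_seg[OF finite_class.finite_UNIV[where 'a = "'a ordered_copy"]]
      by (elim exE conjE) (rule exI)
  qed
  fix x y z :: "'a ordered_copy"
  show "x < y \<longleftrightarrow> x \<le> y \<and> \<not> y \<le> x" "x \<le> x" "x \<le> y \<or> y \<le> x"
    by (auto simp: less_eq_ordered_copy_def less_ordered_copy_def)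
  show "x \<le> z" if "x \<le> y" "y \<le> z"
    using that by (simp add: less_eq_ordered_copy_def)
  show "x = y" if "x \<le> y" "y \<le> x"
    using that inj by (simp add: less_eq_ordered_copy_def inj_eq)
  fix P :: "'a ordered_copy \<Rightarrow> bool" and a
  assume step: "\<And>x. (\<And>y. y < x \<Longrightarrow> P y) \<Longrightarrow> P x"
  show "P a"
    by (induction a rule: measure_induct_rule[of ordered_copy_index])
      (rule step, simp add: less_ordered_copy_def)
qed

end

text \<open>Conjugation by \<open>g\<close> is a bijection between the permutations of the two index
  types that preserves the sign, and it matches the terms of the two Leibniz expansions.\<close>

lemma det_reindex:
  fixes A :: "'a::comm_ring_1^'n::finite^'n" and g :: "'m::finite \<Rightarrow> 'n"
  assumes g: "bij g"
  shows "det (\<chi> i j. A $ g i $ g j) = det A"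
proof -
  let ?h = "inv g"
  have h: "bij ?h" "\<And>i. g (?h i) = i" "\<And>i. ?h (g i) = i"
    using g by (auto simp: bij_imp_bij_inv bij_is_surj surj_f_inv_f bij_is_inj)
  have bij: "bij_betw (\<lambda>p. map_permutation UNIV g p) {p. p permutes UNIV} {p. p permutes UNIV}"
  proof (rule bij_betwI[where g = "\<lambda>p. map_permutation UNIV ?h p"])
    show "map_permutation UNIV g \<in> {p. p permutes UNIV} \<rightarrow> {p. p permutes UNIV}"
      using map_permutation_permutes[OF g] by auto
    show "map_permutation UNIV ?h \<in> {p. p permutes UNIV} \<rightarrow> {p. p permutes UNIV}"
      using map_permutation_permutes[OF h(1)] by auto
    show "map_permutation UNIV ?h (map_permutation UNIV g p) = p" if "p \<in> {p. p permutes UNIV}" for p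
      using that g h by (intro map_permutation_compose_inv[of _ UNIV]) auto
    show "map_permutation UNIV g (map_permutation UNIV ?h p) = p" if "p \<in> {p. p permutes UNIV}" for p
      using that g h by (intro map_permutation_compose_inv[of _ UNIV]) auto
  qed
  have "det A = (\<Sum>p | p permutes (UNIV :: 'm set).
      of_int (sign (map_permutation UNIV g p)) * (\<Prod>i\<in>UNIV. A $ i $ map_permutation UNIV g p i))"
    unfolding det_def by (rule sum.reindex_bij_betw[OF bij, symmetric])
  also have "\<dots> = (\<Sum>p | p permutes (UNIV :: 'm set).
      of_int (sign p) * (\<Prod>i\<in>UNIV. A $ g i $ g (p i)))"
  proof (intro sum.cong refl)
    fix p assume "p \<in> {p. p permutes (UNIV :: 'm set)}"
    then have p: "p permutes UNIV" by simp
    have "(\<Prod>i\<in>UNIV. A $ i $ map_permutation UNIV g p i) = (\<Prod>i\<in>UNIV. A $ g i $ map_permutation UNIV g p (g i))"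
      by (rule prod.reindex_bij_betw[OF g, symmetric])
    then show "of_int (sign (map_permutation UNIV g p)) * (\<Prod>i\<in>UNIV. A $ i $ map_permutation UNIV g p i) =
        of_int (sign p) * (\<Prod>i\<in>UNIV. A $ g i $ g (p i))"
      using g p by (simp add: sign_map_permutation map_permutation_apply bij_is_inj)
  qed
  finally show ?thesis by (simp add: det_def)
qed

lemma integral_change_of_variables_wellorder:
  fixes f :: "real^'n::{finite,wellorder} \<Rightarrow> complex" and g :: "real^'n::_ \<Rightarrow> real^'n::_"
  assumes S: "open S" and der: "\<And>x. x \<in> S \<Longrightarrow> (g has_derivative g' x) (at x)"
    and inj: "inj_on g S" and gS: "open (g ` S)"
    and f: "integrable lborel (\<lambda>y. indicator (g ` S) y *\<^sub>R f y)"
    and D: "(\<lambda>x. indicator S x *\<^sub>R (\<bar>det (matrix (g' x))\<bar> *\<^sub>R f (g x))) \<in> borel_measurable borel"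
  shows "(\<integral>y. indicator (g ` S) y *\<^sub>R f y \<partial>lborel) =
    (\<integral>x. indicator S x *\<^sub>R (\<bar>det (matrix (g' x))\<bar> *\<^sub>R f (g x)) \<partial>lborel)"
proof -
  \<comment> \<open>The theorem \<open>has_absolute_integral_change_of_variables\<close> is about
    integrands with values in a space of real vectors; the linear isomorphism \<open>T\<close> with
    inverse \<open>R\<close> carries complex values there and back. Hypothesis \<open>D\<close> is
    what allows the return from \<open>lebesgue\<close> to \<open>lborel\<close> at the end.\<close>
  define T :: "complex \<Rightarrow> real^2" where "T z = (\<chi> i. if i = 1 then Re z else Im z)" for z
  define R :: "real^2 \<Rightarrow> complex" where "R v = Complex (v $ 1) (v $ 2)" for v
  have RT: "R (T z) = z" for z by (simp add: R_def T_def)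
  have "linear T" by (rule linearI) (auto simp: T_def vec_eq_iff)
  then have T: "bounded_linear T" by (rule linear_conv_bounded_linear[THEN iffD1])
  have "linear R" by (rule linearI) (auto simp: R_def complex_eq_iff)
  then have R: "bounded_linear R" by (rule linear_conv_bounded_linear[THEN iffD1])
  let ?D = "\<lambda>x. \<bar>det (matrix (g' x))\<bar> *\<^sub>R f (g x)"
  have Sm: "S \<in> sets lebesgue" "g ` S \<in> sets lebesgue" using S gS by auto
  have der': "(g has_derivative g' x) (at x within S)" if "x \<in> S" for x
    using der[OF that] by (rule has_derivative_at_withinI)
  have "integrable lebesgue (\<lambda>y. indicator (g ` S) y *\<^sub>R f y)"
    by (subst integrable_completion) (use f in auto)
  then have fi: "integrable (lebesgue_on (g ` S)) f"
    using Sm by (subst integrable_restrict_space) auto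
  then have "integrable (lebesgue_on (g ` S)) (\<lambda>y. T (f y))"
    by (rule integrable_bounded_linear[OF T])
  then have Tf: "(\<lambda>y. T (f y)) absolutely_integrable_on g ` S"
    using Sm by (simp add: set_integrable_def integrable_restrict_space)
  have "(\<lambda>x. \<bar>det (matrix (g' x))\<bar> *\<^sub>R T (f (g x))) absolutely_integrable_on S \<and>
      integral S (\<lambda>x. \<bar>det (matrix (g' x))\<bar> *\<^sub>R T (f (g x))) = integral (g ` S) (\<lambda>y. T (f y))"
    using has_absolute_integral_change_of_variables[OF Sm(1) der' inj, of "\<lambda>y. T (f y)"] Tf by simp
  then have *: "(\<lambda>x. T (?D x)) absolutely_integrable_on S"
      "integral S (\<lambda>x. T (?D x)) = integral (g ` S) (\<lambda>y. T (f y))"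
    by (simp_all add: linear_scale[OF bounded_linear.linear[OF T]])
  have TDi: "integrable (lebesgue_on S) (\<lambda>x. T (?D x))"
    by (rule absolutely_integrable_imp_integrable[OF *(1) Sm(1)])
  then have Di: "integrable (lebesgue_on S) ?D"
    using integrable_bounded_linear[OF R TDi] by (simp add: RT)
  have "T (integral\<^sup>L (lebesgue_on S) ?D) = integral\<^sup>L (lebesgue_on S) (\<lambda>x. T (?D x))"
    by (rule integral_bounded_linear[OF T Di, symmetric])
  also have "\<dots> = integral S (\<lambda>x. T (?D x))"
    by (rule lebesgue_integral_eq_integral[OF TDi Sm(1)])
  also have "\<dots> = integral\<^sup>L (lebesgue_on (g ` S)) (\<lambda>y. T (f y))"
    unfolding *(2)
    by (rule lebesgue_integral_eq_integral[OF integrable_bounded_linear[OF T fi] Sm(2), symmetric])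
  also have "\<dots> = T (integral\<^sup>L (lebesgue_on (g ` S)) f)"
    by (rule integral_bounded_linear[OF T fi])
  finally have eq: "integral\<^sup>L (lebesgue_on (g ` S)) f = integral\<^sup>L (lebesgue_on S) ?D"
    using RT[of "integral\<^sup>L (lebesgue_on (g ` S)) f"] RT[of "integral\<^sup>L (lebesgue_on S) ?D"] by simp
  have "(\<integral>y. indicator (g ` S) y *\<^sub>R f y \<partial>lborel) = (\<integral>y. indicator (g ` S) y *\<^sub>R f y \<partial>lebesgue)"
    by (rule integral_completion[symmetric]) (use f in auto)
  also have "\<dots> = integral\<^sup>L (lebesgue_on (g ` S)) f"
    using Sm by (subst integral_restrict_space) auto
  also have "\<dots> = integral\<^sup>L lebesgue (\<lambda>x. indicator S x *\<^sub>R ?D x)"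
    unfolding eq using Sm by (subst integral_restrict_space) auto
  also have "\<dots> = (\<integral>x. indicator S x *\<^sub>R ?D x \<partial>lborel)"
    by (rule integral_completion) (use D in auto)
  finally show ?thesis .
qed

section \<open>Lebesgue measure and change of variables under a relabelling of coordinates\<close>

definition reindex :: "('m \<Rightarrow> 'n) \<Rightarrow> real^'n \<Rightarrow> real^'m" where
  "reindex \<sigma> x = (\<chi> i. x $ \<sigma> i)"

lemma linear_reindex: "linear (reindex \<sigma> :: real^'n::finite \<Rightarrow> real^'m::finite)"
  by (rule linearI) (auto simp: reindex_def vec_eq_iff)

lemma continuous_on_reindex: "continuous_on S (reindex \<sigma> :: real^'n::finite \<Rightarrow> real^'m::finite)"
  by (rule linear_continuous_on[OF linear_reindex[unfolded linear_conv_bounded_linear]])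

text \<open>It suffices to compare the measures of boxes. The preimage of a box is a box with the
  same side lengths in another order, so the two products agree.\<close>

lemma lborel_reindex:
  fixes \<sigma> :: "'m::finite \<Rightarrow> 'n::finite"
  assumes "bij \<sigma>"
  shows "distr lborel borel (reindex \<sigma> :: real^'n \<Rightarrow> real^'m) = lborel"
proof (rule lborel_eqI[symmetric])
  fix l u :: "real^'m" assume le: "\<And>b. b \<in> Basis \<Longrightarrow> l \<bullet> b \<le> u \<bullet> b"
  let ?\<tau> = "inv \<sigma>"
  have \<tau>: "\<And>i. \<sigma> (?\<tau> i) = i" "\<And>i. ?\<tau> (\<sigma> i) = i" "bij ?\<tau>"
    using assms by (auto simp: bij_is_surj surj_f_inv_f bij_is_inj bij_imp_bij_inv)
  have le': "l $ i \<le> u $ i" for i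
    using le[of "axis i 1"] by (simp add: inner_axis axis_in_Basis_iff)
  have m: "reindex \<sigma> \<in> borel_measurable (lborel :: (real^'n) measure)"
    using borel_measurable_continuous_onI[OF continuous_on_reindex] by simp
  have all_reindex: "(\<forall>i. A (\<sigma> i)) \<longleftrightarrow> (\<forall>i. A i)" for A
  proof safe
    fix i assume "\<forall>i. A (\<sigma> i)"
    then have "A (\<sigma> (?\<tau> i))" ..
    then show "A i" by (simp add: \<tau>)
  qed simp
  have vim: "reindex \<sigma> -` box l u = box (reindex ?\<tau> l) (reindex ?\<tau> u)"
  proof -
    have "(\<forall>i. l $ i < x $ \<sigma> i \<and> x $ \<sigma> i < u $ i) \<longleftrightarrow>
        (\<forall>i. l $ ?\<tau> i < x $ i \<and> x $ i < u $ ?\<tau> i)" for x :: "real^'n"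
      using all_reindex[of "\<lambda>i. l $ ?\<tau> i < x $ i \<and> x $ i < u $ ?\<tau> i"] by (simp add: \<tau>)
    then show ?thesis by (auto simp: reindex_def mem_box_cart)
  qed
  have "emeasure (distr lborel borel (reindex \<sigma>)) (box l u) = emeasure lborel (box (reindex ?\<tau> l) (reindex ?\<tau> u))"
    by (subst emeasure_distr[OF m]) (auto simp: vim)
  also have "\<dots> = (\<Prod>b\<in>Basis. (reindex ?\<tau> u - reindex ?\<tau> l) \<bullet> b)"
    using le' by (subst emeasure_lborel_box)
      (auto simp: Basis_vec_def inner_axis reindex_def)
  also have "(\<Prod>b\<in>Basis. (reindex ?\<tau> u - reindex ?\<tau> l) \<bullet> b) = (\<Prod>i\<in>UNIV. u $ ?\<tau> i - l $ ?\<tau> i)"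
    by (simp add: Basis_vec_def UNION_singleton_eq_range prod.reindex inj_on_def axis_eq_axis inner_axis reindex_def)
  also have "\<dots> = (\<Prod>i\<in>UNIV. u $ i - l $ i)"
    by (rule prod.reindex_bij_betw[OF \<tau>(3)])
  also have "\<dots> = (\<Prod>b\<in>Basis. (u - l) \<bullet> b)"
    by (simp add: Basis_vec_def UNION_singleton_eq_range prod.reindex inj_on_def axis_eq_axis inner_axis)
  finally show "emeasure (distr lborel borel (reindex \<sigma>)) (box l u) = ennreal (\<Prod>b\<in>Basis. (u - l) \<bullet> b)" .
qed simp

lemma integral_reindex:
  fixes \<sigma> :: "'m::finite \<Rightarrow> 'n::finite" and f :: "real^'m \<Rightarrow> complex"
  assumes "bij \<sigma>" "f \<in> borel_measurable borel"
  shows "(\<integral>x. f (reindex \<sigma> x) \<partial>lborel) = integral\<^sup>L lborel f"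
    and "integrable lborel (\<lambda>x. f (reindex \<sigma> x)) \<longleftrightarrow> integrable lborel f"
proof -
  have m: "reindex \<sigma> \<in> measurable (lborel :: (real^'n) measure) borel"
    using borel_measurable_continuous_onI[OF continuous_on_reindex] by simp
  show "(\<integral>x. f (reindex \<sigma> x) \<partial>lborel) = integral\<^sup>L lborel f"
    using integral_distr[OF m assms(2)] by (simp add: lborel_reindex[OF assms(1)])
  show "integrable lborel (\<lambda>x. f (reindex \<sigma> x)) \<longleftrightarrow> integrable lborel f"
    using integrable_distr_eq[OF m assms(2)] by (simp add: lborel_reindex[OF assms(1)])
qed

text \<open>The map \<open>g\<close> is conjugated by the relabellings \<open>P\<close> and
  \<open>Q\<close>. They preserve the measure, and the Jacobian matrix has its rows and columns
  relabelled by the same bijection, which leaves the determinant unchanged by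
  \<open>det_reindex\<close>.\<close>

lemma integral_change_of_variables_complex:
  fixes f :: "real^'n::finite \<Rightarrow> complex" and g :: "real^'n::_ \<Rightarrow> real^'n::_"
  assumes S: "open S" and der: "\<And>x. x \<in> S \<Longrightarrow> (g has_derivative g' x) (at x)"
    and inj: "inj_on g S" and gS: "open (g ` S)"
    and f: "integrable lborel (\<lambda>y. indicator (g ` S) y *\<^sub>R f y)"
    and D: "(\<lambda>x. indicator S x *\<^sub>R (\<bar>det (matrix (g' x))\<bar> *\<^sub>R f (g x))) \<in> borel_measurable borel"
  shows "(\<integral>y. indicator (g ` S) y *\<^sub>R f y \<partial>lborel) =
    (\<integral>x. indicator S x *\<^sub>R (\<bar>det (matrix (g' x))\<bar> *\<^sub>R f (g x)) \<partial>lborel)"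
proof -
  let ?\<sigma> = "of_ordered_copy :: 'n ordered_copy \<Rightarrow> 'n" and ?\<rho> = "to_ordered_copy :: 'n \<Rightarrow> 'n ordered_copy"
  have \<sigma>\<rho>: "?\<sigma> (?\<rho> i) = i" "?\<rho> (?\<sigma> j) = j" for i j
    by (simp_all add: to_ordered_copy_inverse of_ordered_copy_inverse)
  have \<rho>: "bij ?\<rho>" by (rule o_bij[of ?\<sigma>]) (auto simp: \<sigma>\<rho>)
  define P where "P = (reindex ?\<rho> :: real^'n ordered_copy \<Rightarrow> real^'n)"
  define Q where "Q = (reindex ?\<sigma> :: real^'n \<Rightarrow> real^'n ordered_copy)"
  have PQ: "P (Q x) = x" "Q (P y) = y" for x y
    by (simp_all add: P_def Q_def reindex_def \<sigma>\<rho>)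
  have lin: "linear P" "linear Q" by (simp_all add: P_def Q_def linear_reindex)
  have cont: "continuous_on U P" "continuous_on V Q" for U V
    by (simp_all add: P_def Q_def continuous_on_reindex)
  let ?S = "P -` S" and ?g = "\<lambda>x. Q (g (P x))" and ?g' = "\<lambda>x v. Q (g' (P x) (P v))"
  have img: "?g ` ?S = P -` (g ` S)"
  proof safe
    fix y s assume *: "P y = g s" "s \<in> S"
    show "y \<in> ?g ` ?S"
    proof (rule image_eqI)
      show "y = ?g (Q s)" using PQ(2)[of y] by (simp add: PQ *(1))
      show "Q s \<in> ?S" by (simp add: PQ *(2))
    qed
  qed (auto simp: PQ)
  have det: "det (matrix (?g' x)) = det (matrix (g' (P x)))" if "x \<in> ?S" for x
  proof -
    have "matrix (?g' x) = (\<chi> i j. matrix (g' (P x)) $ ?\<sigma> i $ ?\<sigma> j)"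
    proof -
      have P_axis: "P (axis j 1) = axis (?\<sigma> j) 1" for j
        by (auto simp: P_def reindex_def axis_def vec_eq_iff \<sigma>\<rho>)
      show ?thesis
        by (simp add: matrix_def P_axis) (simp add: Q_def reindex_def)
    qed
    then show ?thesis by (simp add: det_reindex[OF bij_of_ordered_copy])
  qed
  have D': "indicator ?S x *\<^sub>R (\<bar>det (matrix (?g' x))\<bar> *\<^sub>R f (P (?g x))) =
      indicator S (P x) *\<^sub>R (\<bar>det (matrix (g' (P x)))\<bar> *\<^sub>R f (g (P x)))" for x
    using det[of x] by (simp add: indicator_def PQ)
  have f': "indicator (?g ` ?S) y *\<^sub>R f (P y) = indicator (g ` S) (P y) *\<^sub>R f (P y)" for y
    unfolding img by (simp add: indicator_def)
  have fm: "(\<lambda>y. indicator (g ` S) y *\<^sub>R f y) \<in> borel_measurable borel" using f by auto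
  have "(\<integral>y. indicator (g ` S) y *\<^sub>R f y \<partial>lborel) = (\<integral>y. indicator (g ` S) (P y) *\<^sub>R f (P y) \<partial>lborel)"
    unfolding P_def by (rule integral_reindex(1)[OF \<rho> fm, symmetric])
  also have "\<dots> = (\<integral>y. indicator (?g ` ?S) y *\<^sub>R f (P y) \<partial>lborel)"
    unfolding f' ..
  also have "\<dots> = (\<integral>x. indicator ?S x *\<^sub>R (\<bar>det (matrix (?g' x))\<bar> *\<^sub>R f (P (?g x))) \<partial>lborel)"
  proof (rule integral_change_of_variables_wellorder)
    show "open ?S" using open_vimage[OF S cont(1)] .
    show "(?g has_derivative ?g' x) (at x)" if "x \<in> ?S" for x
    proof -
      have "(P has_derivative P) (at x)"
        using linear_imp_has_derivative[OF lin(1)] .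
      moreover have "(g has_derivative g' (P x)) (at (P x))" using der that by simp
      ultimately have "((\<lambda>x. g (P x)) has_derivative (\<lambda>v. g' (P x) (P v))) (at x)"
        by (rule has_derivative_compose)
      then show ?thesis
        by (rule bounded_linear.has_derivative[OF lin(2)[unfolded linear_conv_bounded_linear]])
    qed
    show "inj_on ?g ?S"
    proof (rule inj_onI)
      fix x y assume xy: "x \<in> ?S" "y \<in> ?S" "?g x = ?g y"
      from xy(3) have "P (?g x) = P (?g y)" by simp
      then have "g (P x) = g (P y)" by (simp only: PQ)
      then have "P x = P y" by (rule inj_onD[OF inj]) (use xy(1,2) in simp_all)
      then have "Q (P x) = Q (P y)" by simp
      then show "x = y" by (simp only: PQ)
    qed
    show "open (?g ` ?S)" unfolding img using open_vimage[OF gS cont(1)] .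
    show "integrable lborel (\<lambda>y. indicator (?g ` ?S) y *\<^sub>R f (P y))"
      unfolding f' using integral_reindex(2)[OF \<rho> fm] f by (simp add: P_def)
    show "(\<lambda>x. indicator ?S x *\<^sub>R (\<bar>det (matrix (?g' x))\<bar> *\<^sub>R f (P (?g x)))) \<in> borel_measurable borel"
      unfolding D' using measurable_compose[OF borel_measurable_continuous_onI[OF cont(1)] D] .
  qed
  also have "\<dots> = (\<integral>x. indicator S x *\<^sub>R (\<bar>det (matrix (g' x))\<bar> *\<^sub>R f (g x)) \<partial>lborel)"
    unfolding D' unfolding P_def by (rule integral_reindex(1)[OF \<rho> D])
  finally show ?thesis .
qed

section \<open>Distributions given by bounded functions\<close>

lemma integral_lebesgue_on_lborel:
  fixes F :: "'a::euclidean_space \<Rightarrow> 'b::euclidean_space"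
  assumes "W \<in> sets borel" "(\<lambda>x. indicator W x *\<^sub>R F x) \<in> borel_measurable borel"
  shows "integral\<^sup>L (lebesgue_on W) F = (\<integral>x. indicator W x *\<^sub>R F x \<partial>lborel)"
proof -
  have "integral\<^sup>L (lebesgue_on W) F = (\<integral>x. indicator W x *\<^sub>R F x \<partial>lebesgue)"
    using assms(1) by (subst integral_restrict_space) auto
  also have "\<dots> = (\<integral>x. indicator W x *\<^sub>R F x \<partial>lborel)"
    by (rule integral_completion) (use assms(2) in simp)
  finally show ?thesis .
qed

lemma test_function_continuous: "\<phi> \<in> test_functions W \<Longrightarrow> continuous_on UNIV \<phi>"
  by (simp add: test_functions_def smooth_on_continuous_on)

lemma test_function_outside: "\<phi> \<in> test_functions W \<Longrightarrow> x \<notin> W \<Longrightarrow> \<phi> x = 0"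
  unfolding test_functions_def using tsupp_notin by blast

lemma test_function_integrable:
  fixes \<phi> :: "real^'n::finite \<Rightarrow> complex"
  assumes "\<phi> \<in> test_functions W"
  shows "integrable lborel \<phi>"
proof (rule integrable_continuous_compact_support[OF test_function_continuous[OF assms]])
  show "compact (tsupp \<phi>)" using assms by (simp add: test_functions_def)
qed (rule tsupp_notin)

lemma indicator_mult_measurable:
  fixes h g :: "'a::topological_space \<Rightarrow> complex"
  assumes "(\<lambda>x. indicator W x *\<^sub>R h x) \<in> borel_measurable borel" "W \<in> sets borel"
    "continuous_on W g"
  shows "(\<lambda>x. indicator W x *\<^sub>R (h x * g x)) \<in> borel_measurable borel"
proof -
  have "(\<lambda>x. (indicator W x *\<^sub>R h x) * (indicator W x *\<^sub>R g x)) \<in> borel_measurable borel"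
    by (intro borel_measurable_times assms(1) borel_measurable_continuous_on_indicator[OF assms(2,3)])
  also have "(\<lambda>x. (indicator W x *\<^sub>R h x) * (indicator W x *\<^sub>R g x)) =
      (\<lambda>x. indicator W x *\<^sub>R (h x * g x))"
    by (auto simp: indicator_def)
  finally show ?thesis .
qed

lemma bounded_mult_test_function:
  fixes h :: "real^'n::finite \<Rightarrow> complex"
  assumes W: "open W" and h: "(\<lambda>x. indicator W x *\<^sub>R h x) \<in> borel_measurable borel"
    and B: "\<And>x. x \<in> W \<Longrightarrow> cmod (h x) \<le> B" and \<phi>: "\<phi> \<in> test_functions W'"
  shows "(\<lambda>x. indicator W x *\<^sub>R (h x * \<phi> x)) \<in> borel_measurable borel"
    and "integrable lborel (\<lambda>x. indicator W x *\<^sub>R (h x * \<phi> x))"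
    and "integral\<^sup>L (lebesgue_on W) (\<lambda>x. h x * \<phi> x) = (\<integral>x. indicator W x *\<^sub>R (h x * \<phi> x) \<partial>lborel)"
proof -
  show *: "(\<lambda>x. indicator W x *\<^sub>R (h x * \<phi> x)) \<in> borel_measurable borel"
    by (rule indicator_mult_measurable[OF h borel_open[OF W]
          continuous_on_subset[OF test_function_continuous[OF \<phi>] subset_UNIV]])
  show "integral\<^sup>L (lebesgue_on W) (\<lambda>x. h x * \<phi> x) = (\<integral>x. indicator W x *\<^sub>R (h x * \<phi> x) \<partial>lborel)"
    by (rule integral_lebesgue_on_lborel[OF borel_open[OF W] *])
  have "norm (indicator W x *\<^sub>R h x) \<le> max B 0" for x
    using B[of x] by (cases "x \<in> W") auto
  then have "integrable lborel (\<lambda>x. (indicator W x *\<^sub>R h x) * \<phi> x)"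
    using h by (intro integrable_bounded_mult[OF _ _ test_function_integrable[OF \<phi>]]) auto
  then show "integrable lborel (\<lambda>x. indicator W x *\<^sub>R (h x * \<phi> x))" by simp
qed

lemma distribution_on_bounded_function:
  fixes h :: "real^'n::finite \<Rightarrow> complex"
  assumes W: "open W" and h: "(\<lambda>x. indicator W x *\<^sub>R h x) \<in> borel_measurable borel"
    and B: "\<And>x. x \<in> W \<Longrightarrow> cmod (h x) \<le> B"
  shows "distribution_on W (\<lambda>\<phi>. integral\<^sup>L (lebesgue_on W) (\<lambda>x. h x * \<phi> x))"
proof -
  have facts: "(\<lambda>x. indicator W x *\<^sub>R (h x * \<phi> x)) \<in> borel_measurable borel"
      "integrable lborel (\<lambda>x. indicator W x *\<^sub>R (h x * \<phi> x))"
      "integral\<^sup>L (lebesgue_on W) (\<lambda>x. h x * \<phi> x) = (\<integral>x. indicator W x *\<^sub>R (h x * \<phi> x) \<partial>lborel)"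
    if "\<phi> \<in> test_functions W" for \<phi>
    by (rule bounded_mult_test_function[OF W h _ that]; rule B; assumption)+
  have add: "integral\<^sup>L (lebesgue_on W) (\<lambda>x. h x * (\<phi> x + \<psi> x)) =
      integral\<^sup>L (lebesgue_on W) (\<lambda>x. h x * \<phi> x) + integral\<^sup>L (lebesgue_on W) (\<lambda>x. h x * \<psi> x)"
    if \<phi>: "\<phi> \<in> test_functions W" and \<psi>: "\<psi> \<in> test_functions W" for \<phi> \<psi>
  proof -
    have eq: "indicator W x *\<^sub>R (h x * (\<phi> x + \<psi> x)) =
        indicator W x *\<^sub>R (h x * \<phi> x) + indicator W x *\<^sub>R (h x * \<psi> x)" for x
      by (simp add: algebra_simps)
    have "integral\<^sup>L (lebesgue_on W) (\<lambda>x. h x * (\<phi> x + \<psi> x)) =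
        (\<integral>x. indicator W x *\<^sub>R (h x * (\<phi> x + \<psi> x)) \<partial>lborel)"
      by (rule integral_lebesgue_on_lborel[OF borel_open[OF W]])
        (unfold eq, intro borel_measurable_add facts(1)[OF \<phi>] facts(1)[OF \<psi>])
    then show ?thesis
      unfolding eq facts(3)[OF \<phi>] facts(3)[OF \<psi>]
      by (simp only: Bochner_Integration.integral_add[OF facts(2)[OF \<phi>] facts(2)[OF \<psi>]])
  qed
  have bd: "\<exists>C k. \<forall>\<phi>\<in>test_functions W. tsupp \<phi> \<subseteq> K \<longrightarrow>
      cmod (integral\<^sup>L (lebesgue_on W) (\<lambda>x. h x * \<phi> x)) \<le>
      C * (\<Sum>js | length js \<le> k. SUP x. cmod (iter_partial js \<phi> x))" if K: "compact K" for K
  \<comment> \<open>A bounded function defines a distribution of order 0: for \<open>k = 0\<close>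
    only the empty list of derivatives contributes, and the constant is the bound of
    \<open>h\<close> times the volume of \<open>K\<close>.\<close>
  proof (rule exI[of _ "max B 0 * measure lborel K"], rule exI[of _ 0], intro ballI impI)
    fix \<phi> assume \<phi>: "\<phi> \<in> test_functions W" and sub: "tsupp \<phi> \<subseteq> K"
    let ?s = "SUP x. cmod (\<phi> x)"
    have "compact (tsupp \<phi>)" using \<phi> by (simp add: test_functions_def)
    then obtain C where C: "\<And>x. cmod (\<phi> x) \<le> C"
      by (rule continuous_compact_support_bounded[OF test_function_continuous[OF \<phi>]])
        (auto intro: tsupp_notin)
    have s: "cmod (\<phi> x) \<le> ?s" for x
      by (rule cSUP_upper) (auto intro!: bdd_aboveI2[of _ _ C] C)
    have intK: "integrable lborel (\<lambda>x. max B 0 * ?s * indicator K x)"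
      using borel_integrable_compact[OF K, of "\<lambda>_. max B 0 * ?s"] by (simp add: mult.commute)
    have "cmod (\<integral>x. indicator W x *\<^sub>R (h x * \<phi> x) \<partial>lborel) \<le> (\<integral>x. max B 0 * ?s * indicator K x \<partial>lborel)"
    proof (rule Bochner_Integration.integral_norm_bound_integral[OF facts(2)[OF \<phi>] intK])
      fix x
      show "norm (indicator W x *\<^sub>R (h x * \<phi> x)) \<le> max B 0 * ?s * indicator K x"
      proof (cases "x \<in> K \<and> x \<in> W")
        case True
        then have "cmod (h x) * cmod (\<phi> x) \<le> max B 0 * ?s"
          using B[of x] s[of x] by (intro mult_mono) auto
        then show ?thesis using True by (simp add: norm_mult)
      next
        case False
        then have "indicator W x *\<^sub>R (h x * \<phi> x) = 0"
          using sub tsupp_notin[of x \<phi>] by (auto simp: indicator_def)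
        moreover have "0 \<le> ?s" using s[of x] norm_ge_zero[of "\<phi> x"] by linarith
        ultimately show ?thesis by (simp only: norm_zero) simp
      qed
    qed
    also have "\<dots> = max B 0 * measure lborel K * ?s"
      using K by (simp add: borel_compact)
    also have "?s = (\<Sum>js | length js \<le> 0. SUP x. cmod (iter_partial js \<phi> x))"
      by (simp add: iter_partial_def)
    finally show "cmod (integral\<^sup>L (lebesgue_on W) (\<lambda>x. h x * \<phi> x)) \<le>
        max B 0 * measure lborel K * (\<Sum>js | length js \<le> 0. SUP x. cmod (iter_partial js \<phi> x))"
      unfolding facts(3)[OF \<phi>] .
  qed
  have scale: "integral\<^sup>L (lebesgue_on W) (\<lambda>x. h x * (c * \<phi> x)) = c * integral\<^sup>L (lebesgue_on W) (\<lambda>x. h x * \<phi> x)"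
    for c \<phi>
    by (simp add: mult.left_commute[of _ c])
  show ?thesis
    unfolding distribution_on_def using add scale bd by blast
qed

lemma L2_loc_bounded:
  assumes W: "open W" and h: "(\<lambda>x. indicator W x *\<^sub>R h x) \<in> borel_measurable borel"
    and B: "\<And>x. x \<in> W \<Longrightarrow> cmod (h x) \<le> B"
  shows "L2_loc W h"
  unfolding L2_loc_def
proof (intro conjI allI impI)
  have "(\<lambda>x. indicator W x *\<^sub>R h x) \<in> borel_measurable lebesgue"
    using measurable_completion[of _ lborel borel] h by simp
  then show "h \<in> borel_measurable (lebesgue_on W)"
    using W by (subst borel_measurable_restrict_space_iff) auto
  fix K assume K: "compact K \<and> K \<subseteq> W"
  have "integrable lborel (\<lambda>x. indicator K x *\<^sub>R (cmod (h x))\<^sup>2)"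
  proof (rule Bochner_Integration.integrable_bound)
    show "integrable lborel (\<lambda>x. indicator K x *\<^sub>R (max B 0)\<^sup>2)"
      using borel_integrable_compact[of K "\<lambda>_. (max B 0)\<^sup>2"] K by simp
    have "(\<lambda>x. indicator K x *\<^sub>R (cmod (indicator W x *\<^sub>R h x))\<^sup>2) \<in> borel_measurable lborel"
    proof (rule borel_measurable_scaleR)
      show "indicator K \<in> borel_measurable lborel"
        using K by (intro borel_measurable_indicator) (simp add: borel_compact)
      have [measurable]: "(\<lambda>x. indicator W x *\<^sub>R h x) \<in> borel_measurable lborel" using h by simp
      show "(\<lambda>x. (cmod (indicator W x *\<^sub>R h x))\<^sup>2) \<in> borel_measurable lborel"
        by measurable
    qed
    also have "(\<lambda>x. indicator K x *\<^sub>R (cmod (indicator W x *\<^sub>R h x))\<^sup>2) = (\<lambda>x. indicator K x *\<^sub>R (cmod (h x))\<^sup>2)"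
    proof
      fix x
      show "indicator K x *\<^sub>R (cmod (indicator W x *\<^sub>R h x))\<^sup>2 = indicator K x *\<^sub>R (cmod (h x))\<^sup>2"
        using K by (cases "x \<in> K") auto
    qed
    finally show "(\<lambda>x. indicator K x *\<^sub>R (cmod (h x))\<^sup>2) \<in> borel_measurable lborel" .
    have "norm (indicator K x *\<^sub>R (cmod (h x))\<^sup>2) \<le> norm (indicator K x *\<^sub>R (max B 0)\<^sup>2)" for x
    proof (cases "x \<in> K")
      case True
      then have "cmod (h x) \<le> max B 0" using K B[of x] by auto
      then have "(cmod (h x))\<^sup>2 \<le> (max B 0)\<^sup>2" by (rule power_mono) simp
      then show ?thesis using True by simp
    qed simp
    then show "AE x in lborel. norm (indicator K x *\<^sub>R (cmod (h x))\<^sup>2) \<le> norm (indicator K x *\<^sub>R (max B 0)\<^sup>2)"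
      by simp
  qed
  then have "integrable lebesgue (\<lambda>x. indicator K x *\<^sub>R (cmod (h x))\<^sup>2)"
    by (subst integrable_completion) auto
  then show "integrable (lebesgue_on K) (\<lambda>x. (cmod (h x))\<^sup>2)"
    using K by (subst integrable_restrict_space) (auto simp: borel_compact)
qed

text \<open>The fundamental lemma is applied to \<open>g - h\<close>. Continuity on an open set
  gives no bound near the boundary, so the integrability needed to split the integral is taken from
  the compact set \<open>tsupp \<phi>\<close> inside \<open>W\<close>.\<close>

lemma continuous_weakly_eq_imp_eq:
  fixes g h :: "real^'n::finite \<Rightarrow> complex"
  assumes W: "open W" and g: "continuous_on W g" and h: "continuous_on W h"
    and eq: "\<And>\<phi>. \<phi> \<in> test_functions W \<Longrightarrow>
      (\<integral>x. indicator W x *\<^sub>R (g x * \<phi> x) \<partial>lborel) = (\<integral>x. indicator W x *\<^sub>R (h x * \<phi> x) \<partial>lborel)"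
    and x: "x \<in> W"
  shows "g x = h x"
proof -
  have int: "integrable lborel (\<lambda>x. indicator W x *\<^sub>R (k x * \<phi> x))"
    if k: "continuous_on W k" and \<phi>: "\<phi> \<in> test_functions W" for k \<phi>
  proof -
    have K: "compact (tsupp \<phi>)" "tsupp \<phi> \<subseteq> W" using \<phi> by (auto simp: test_functions_def)
    have "integrable lborel (\<lambda>x. indicator (tsupp \<phi>) x *\<^sub>R (k x * \<phi> x))"
      by (intro borel_integrable_compact K continuous_on_mult continuous_on_subset[OF k K(2)]
          continuous_on_subset[OF test_function_continuous[OF \<phi>] subset_UNIV])
    also have "(\<lambda>x. indicator (tsupp \<phi>) x *\<^sub>R (k x * \<phi> x)) = (\<lambda>x. indicator W x *\<^sub>R (k x * \<phi> x))"
    proof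
      fix x show "indicator (tsupp \<phi>) x *\<^sub>R (k x * \<phi> x) = indicator W x *\<^sub>R (k x * \<phi> x)"
        using K(2) tsupp_notin[of x \<phi>] by (cases "x \<in> tsupp \<phi>") auto
    qed
    finally show ?thesis .
  qed
  have "(\<lambda>x. g x - h x) x = 0"
  proof (rule continuous_orthogonal_test_functions[OF W _ _ x])
    show "continuous_on W (\<lambda>x. g x - h x)" by (intro continuous_intros g h)
    fix \<phi> assume \<phi>: "\<phi> \<in> test_functions W"
    have "(\<integral>x. indicator W x *\<^sub>R (g x * \<phi> x) - indicator W x *\<^sub>R (h x * \<phi> x) \<partial>lborel) = 0"
      by (simp add: Bochner_Integration.integral_diff[OF int[OF g \<phi>] int[OF h \<phi>]] eq[OF \<phi>])
    then show "(\<integral>x. indicator W x *\<^sub>R ((g x - h x) * \<phi> x) \<partial>lborel) = 0"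
      by (simp add: algebra_simps)
  qed
  then show ?thesis by simp
qed

section \<open>The oscillating function\<close>

text \<open>This is \<open>z\<^sup>i\<close>; \<open>Ln 0\<close> is unspecified. The shifts tend to \<open>0\<close> through points where \<open>z\<^sup>i = 1\<close>, so that
  with the value \<open>1\<close> at \<open>0\<close> the shifted functions converge at every point, even if \<open>f = c\<close> on a
  set of positive measure.\<close>

definition osc :: "complex \<Rightarrow> complex" where
  "osc z = (if z = 0 then 1 else exp (\<i> * Ln z))"

definition osc_shift :: "nat \<Rightarrow> real" where
  "osc_shift n = exp (- (2 * pi * real n))"

lemma Re_pos_notin_nonpos: "0 < Re z \<Longrightarrow> z \<notin> \<real>\<^sub>\<le>\<^sub>0"
  by (auto simp: complex_nonpos_Reals_iff)

lemma Re_nonneg_notin_nonpos: "0 \<le> Re z \<Longrightarrow> z \<noteq> 0 \<Longrightarrow> z \<notin> \<real>\<^sub>\<le>\<^sub>0"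
  by (auto simp: complex_nonpos_Reals_iff complex_eq_iff)

lemma osc_has_field_derivative:
  assumes "z \<notin> \<real>\<^sub>\<le>\<^sub>0"
  shows "(osc has_field_derivative osc z * (\<i> / z)) (at z)"
proof -
  have z: "z \<noteq> 0" using assms by auto
  have "((\<lambda>z. exp (\<i> * Ln z)) has_field_derivative osc z * (\<i> / z)) (at z)"
    using assms z by (auto intro!: derivative_eq_intros simp: divide_inverse osc_def)
  then show ?thesis
    by (rule has_field_derivative_transform_within_open[of _ _ _ "- {0}"]) (use z in \<open>auto simp: osc_def\<close>)
qed

lemma isCont_osc: "z \<notin> \<real>\<^sub>\<le>\<^sub>0 \<Longrightarrow> isCont osc z"
  using osc_has_field_derivative DERIV_isCont by blast

text \<open>This separates the two features that matter: the modulus depends only on the argument of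
  \<open>z\<close>, hence is bounded on a half-plane, and the phase depends only on
  \<open>cmod z\<close>, hence turns without end as \<open>z\<close> approaches 0.\<close>

lemma osc_polar:
  assumes "z \<noteq> 0"
  shows "osc z = of_real (exp (- Im (Ln z))) * exp (\<i> * of_real (ln (cmod z)))"
proof -
  have "\<i> * Ln z = of_real (- Im (Ln z)) + \<i> * of_real (ln (cmod z))"
    using assms by (simp add: complex_eq_iff)
  then show ?thesis using assms unfolding osc_def by (simp only: exp_add exp_of_real if_False)
qed

lemma Im_Ln_bound: "0 \<le> Re z \<Longrightarrow> z \<noteq> 0 \<Longrightarrow> \<bar>Im (Ln z)\<bar> \<le> pi / 2"
  using Re_Ln_pos_le by blast

lemma norm_osc_le:
  assumes "0 \<le> Re z"
  shows "cmod (osc z) \<le> exp (pi / 2)"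
proof (cases "z = 0")
  case True
  then show ?thesis by (simp add: osc_def)
next
  case False
  then show ?thesis
    using Im_Ln_bound[OF assms] by (simp add: osc_polar norm_mult)
qed

lemma osc_shift_lim:
  assumes "0 \<le> Re z"
  shows "(\<lambda>n. osc (z + of_real (osc_shift n))) \<longlonglongrightarrow> osc z"
proof (cases "z = 0")
  case True
  have "osc (of_real (osc_shift n)) = 1" for n
  proof -
    have "osc (of_real (osc_shift n)) = exp (- (\<i> * (of_nat n * (of_real pi * 2))))"
      unfolding osc_def osc_shift_def by (simp add: Ln_of_real mult_ac)
    then show ?thesis by (simp only: exp_minus exp_2pi_1_nat inverse_1)
  qed
  then show ?thesis using True by (simp add: osc_def)
next
  case False
  have "osc_shift \<longlonglongrightarrow> 0"
    unfolding osc_shift_def[abs_def] by real_asymp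
  then have "(\<lambda>n. z + of_real (osc_shift n)) \<longlonglongrightarrow> z + of_real 0"
    by (intro tendsto_intros)
  then show ?thesis
    using isCont_tendsto_compose[OF isCont_osc[OF Re_nonneg_notin_nonpos[OF assms False]]] by simp
qed

text \<open>At these radii the phase \<open>ln (cmod z)\<close> is an even or an odd multiple of pi,
  so the real part is plus or minus the modulus; the modulus is at least
  \<open>exp (- (pi / 2))\<close> because the argument of \<open>z\<close> is at most pi/2.\<close>

lemma Re_osc_oscillates:
  assumes "0 \<le> Re z"
  shows "cmod z = exp (- (2 * pi * real k)) \<Longrightarrow> Re (osc z) \<ge> exp (- (pi / 2))"
    and "cmod z = exp (- (2 * pi * real k + pi)) \<Longrightarrow> Re (osc z) \<le> - exp (- (pi / 2))"
proof -
  have per: "cos (2 * pi * real k) = 1" "sin (2 * pi * real k) = 0"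
    using cos_int_2pin[of "int k"] sin_int_2pin[of "int k"] by simp_all
  have Re: "Re (osc z) = exp (- Im (Ln z)) * cos (ln (cmod z))" if "z \<noteq> 0"
    by (simp add: osc_polar[OF that] Re_exp)
  have ge: "exp (- Im (Ln z)) \<ge> exp (- (pi / 2))" if "z \<noteq> 0"
    using Im_Ln_bound[OF assms that] by simp
  show "Re (osc z) \<ge> exp (- (pi / 2))" if *: "cmod z = exp (- (2 * pi * real k))"
  proof -
    have z: "z \<noteq> 0" using * by auto
    show ?thesis using ge[OF z] by (simp add: Re[OF z] * per)
  qed
  show "Re (osc z) \<le> - exp (- (pi / 2))" if *: "cmod z = exp (- (2 * pi * real k + pi))"
  proof -
    have z: "z \<noteq> 0" using * by auto
    have "cos (ln (cmod z)) = -1" unfolding * ln_exp cos_minus by (simp add: cos_add per)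
    then show ?thesis using ge[OF z] by (simp add: Re[OF z])
  qed
qed

section \<open>Charts and vector fields\<close>

lemma atlas_chart:
  assumes "smooth_atlas A" "\<kappa> \<in> A"
  shows "open (chart_dom \<kappa>)" "open (chart_img \<kappa> UNIV)"
    "homeomorphism (chart_dom \<kappa>) (chart_img \<kappa> UNIV) (chart_map \<kappa>) (chart_inv \<kappa>)"
  using assms unfolding smooth_atlas_def by blast+

lemma atlas_transition:
  assumes "smooth_atlas A" "\<kappa> \<in> A" "\<kappa>' \<in> A"
  shows "smooth_on (chart_img \<kappa> (chart_dom \<kappa>')) (transition \<kappa> \<kappa>')"
  using assms unfolding smooth_atlas_def by blast

lemma atlas_covers:
  assumes "smooth_atlas A"
  obtains \<kappa> where "\<kappa> \<in> A" "q \<in> chart_dom \<kappa>"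
  using assms unfolding smooth_atlas_def by blast

lemma chart_inv_map:
  assumes "smooth_atlas A" "\<kappa> \<in> A" "q \<in> chart_dom \<kappa>"
  shows "chart_inv \<kappa> (chart_map \<kappa> q) = q"
  using homeomorphism_apply1[OF atlas_chart(3)[OF assms(1,2)] assms(3)] .

lemma chart_img_inv:
  assumes "smooth_atlas A" "\<kappa> \<in> A" "y \<in> chart_img \<kappa> U"
  shows "chart_inv \<kappa> y \<in> chart_dom \<kappa>" "chart_inv \<kappa> y \<in> U" "chart_map \<kappa> (chart_inv \<kappa> y) = y"
proof -
  obtain q where q: "q \<in> chart_dom \<kappa>" "q \<in> U" "y = chart_map \<kappa> q"
    using assms(3) by blast
  then show "chart_inv \<kappa> y \<in> chart_dom \<kappa>" "chart_inv \<kappa> y \<in> U" "chart_map \<kappa> (chart_inv \<kappa> y) = y"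
    using chart_inv_map[OF assms(1,2) q(1)] by simp_all
qed

lemma open_chart_img:
  assumes "smooth_atlas A" "\<kappa> \<in> A" "open U"
  shows "open (chart_img \<kappa> U)"
proof -
  note \<kappa> = atlas_chart[OF assms(1,2)]
  have "openin (top_of_set (chart_dom \<kappa>)) (chart_dom \<kappa> \<inter> U)"
    using assms(3) by (simp add: openin_open_Int)
  then have "openin (top_of_set (chart_img \<kappa> UNIV)) (chart_img \<kappa> U)"
    by (rule homeomorphism_imp_open_map[OF \<kappa>(3)])
  then show ?thesis using \<kappa>(2) by (rule openin_open_trans)
qed

lemma open_chart_vimage:
  assumes "smooth_atlas A" "\<kappa> \<in> A" "open B"
  shows "open (chart_map \<kappa> -` B \<inter> chart_dom \<kappa>)"
  using continuous_on_open_vimage[OF atlas_chart(1)[OF assms(1,2)]]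
    homeomorphism_cont1[OF atlas_chart(3)[OF assms(1,2)]] assms(3) by blast

lemma smooth_functionsD:
  "f \<in> smooth_functions A U \<Longrightarrow> \<kappa> \<in> A \<Longrightarrow> smooth_on (chart_img \<kappa> U) (f \<circ> chart_inv \<kappa>)"
  by (simp add: smooth_functions_def)

lemma smooth_functions_continuous_on:
  assumes A: "smooth_atlas A" and U: "open U" and f: "f \<in> smooth_functions A U"
  shows "continuous_on U f"
proof (rule continuous_at_imp_continuous_on, rule ballI)
  fix q assume q: "q \<in> U"
  obtain \<kappa> where \<kappa>: "\<kappa> \<in> A" "q \<in> chart_dom \<kappa>" by (rule atlas_covers[OF A])
  let ?D = "chart_dom \<kappa> \<inter> U"
  have "continuous_on ?D ((f \<circ> chart_inv \<kappa>) \<circ> chart_map \<kappa>)"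
    by (intro continuous_on_compose smooth_on_continuous_on[OF smooth_functionsD[OF f \<kappa>(1)]]
        continuous_on_subset[OF homeomorphism_cont1[OF atlas_chart(3)[OF A \<kappa>(1)]]]) auto
  then have "continuous_on ?D f"
    by (rule continuous_on_eq) (simp add: chart_inv_map[OF A \<kappa>(1)])
  moreover have "open ?D" using atlas_chart(1)[OF A \<kappa>(1)] U by (rule open_Int)
  ultimately show "isCont f q"
    using q \<kappa>(2) by (simp add: continuous_on_eq_continuous_at)
qed

abbreviation coord :: "('m, 'n::finite) chart \<Rightarrow> 'n \<Rightarrow> 'm \<Rightarrow> complex" where
  "coord \<kappa> j \<equiv> \<lambda>q. of_real (chart_map \<kappa> q $ j)"

text \<open>In another chart a coordinate function is a component of the transition map. This admits
  coordinate functions as local arguments of vector fields, from which the coefficients are read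
  off.\<close>

lemma coord_smooth:
  assumes A: "smooth_atlas A" and \<kappa>: "\<kappa> \<in> A"
  shows "coord \<kappa> j \<in> smooth_functions A (chart_dom \<kappa>)"
  unfolding smooth_functions_def
proof (intro CollectI ballI)
  fix \<kappa>' assume \<kappa>': "\<kappa>' \<in> A"
  have L: "bounded_linear (\<lambda>v::real^'b. complex_of_real (v $ j))"
    by (intro bounded_linear_compose[OF bounded_linear_of_real bounded_linear_vec_nth])
  have "Ck_on k (chart_img \<kappa>' (chart_dom \<kappa>)) (\<lambda>y. complex_of_real (transition \<kappa>' \<kappa> y $ j))" for k
  proof (rule Ck_on_bounded_linear[OF L open_chart_img[OF A \<kappa>' atlas_chart(1)[OF A \<kappa>]]])
    show "Ck_on k (chart_img \<kappa>' (chart_dom \<kappa>)) (transition \<kappa>' \<kappa>)"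
      using atlas_transition[OF A \<kappa>' \<kappa>] by (simp only: smooth_on_def)
  qed
  then show "smooth_on (chart_img \<kappa>' (chart_dom \<kappa>)) (coord \<kappa> j \<circ> chart_inv \<kappa>')"
    by (simp add: smooth_on_def o_def)
qed

lemma partial_coord:
  assumes A: "smooth_atlas A" and \<kappa>: "\<kappa> \<in> A" and q: "q \<in> chart_dom \<kappa>"
  shows "partial i (coord \<kappa> j \<circ> chart_inv \<kappa>) (chart_map \<kappa> q) = (if i = j then 1 else 0)"
proof -
  have L: "bounded_linear (\<lambda>v::real^'b. complex_of_real (v $ j))"
    by (intro bounded_linear_compose[OF bounded_linear_of_real bounded_linear_vec_nth])
  have "frechet_derivative (coord \<kappa> j \<circ> chart_inv \<kappa>) (at (chart_map \<kappa> q)) =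
      frechet_derivative (\<lambda>v::real^'b. complex_of_real (v $ j)) (at (chart_map \<kappa> q))"
  proof (rule frechet_derivative_cong_open[OF atlas_chart(2)[OF A \<kappa>]])
    show "chart_map \<kappa> q \<in> chart_img \<kappa> UNIV" using q by simp
    show "(coord \<kappa> j \<circ> chart_inv \<kappa>) y = complex_of_real (y $ j)" if "y \<in> chart_img \<kappa> UNIV" for y
      using chart_img_inv(3)[OF A \<kappa> that] by (simp only: o_apply)
  qed
  also have "\<dots> = (\<lambda>v. complex_of_real (v $ j))"
    by (rule frechet_derivative_eqI[OF bounded_linear_imp_has_derivative[OF L]])
  finally show ?thesis by (simp add: partial_def axis_def)
qed

text \<open>A tangent vector is given only as some combination of coordinate vectors. Applying it to
  the coordinate functions, which are smooth near the point, identifies the unknown coefficients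
  \<open>c\<close> with \<open>vf_coeff\<close>.\<close>

lemma vector_field_in_chart:
  assumes A: "smooth_atlas A" and \<kappa>: "\<kappa> \<in> A" and X: "X \<in> vector_fields A UNIV"
    and y: "y \<in> chart_img \<kappa> U" and U: "open U" and f: "f \<in> smooth_functions A U"
  shows "X (chart_inv \<kappa> y) f = (\<Sum>j\<in>UNIV. vf_coeff \<kappa> X j y * partial j (f \<circ> chart_inv \<kappa>) y)"
proof -
  define q where "q = chart_inv \<kappa> y"
  have q: "q \<in> chart_dom \<kappa>" "q \<in> U" "chart_map \<kappa> q = y"
    using chart_img_inv[OF A \<kappa> y] by (simp_all add: q_def)
  have "X q \<in> complex_tangent_space A q" using X by (simp add: vector_fields_def)
  then obtain c where c: "X q = (\<lambda>f. \<Sum>j\<in>UNIV. c j * coord_vector A \<kappa> j q f)"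
    using \<kappa> q(1) unfolding complex_tangent_space_def by blast
  have "smooth_near A q (coord \<kappa> i)" for i
    unfolding smooth_near_def using coord_smooth[OF A \<kappa>] atlas_chart(1)[OF A \<kappa>] q(1) by blast
  then have cv: "coord_vector A \<kappa> j q (coord \<kappa> i) = (if j = i then 1 else 0)" for i j
    using partial_coord[OF A \<kappa> q(1)] by (simp add: coord_vector_def)
  have "X q (coord \<kappa> i) = c i" for i
  proof -
    have "X q (coord \<kappa> i) = (\<Sum>j\<in>UNIV. c j * (if j = i then 1 else 0))"
      unfolding c cv ..
    also have "\<dots> = c i" by (simp add: if_distrib cong: if_cong)
    finally show ?thesis .
  qed
  then have "vf_coeff \<kappa> X i y = c i" for i by (simp add: vf_coeff_def q_def)
  moreover have "smooth_near A q f" unfolding smooth_near_def using U f q(2) by blast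
  then have "coord_vector A \<kappa> j q f = partial j (f \<circ> chart_inv \<kappa>) y" for j
    by (simp add: coord_vector_def q(3))
  ultimately show ?thesis by (simp add: q_def[symmetric] c)
qed

lemma vf_coeff_smooth:
  assumes A: "smooth_atlas A" and \<kappa>: "\<kappa> \<in> A" and X: "X \<in> vector_fields A UNIV"
  shows "smooth_on (chart_img \<kappa> U) (vf_coeff \<kappa> X j)"
proof -
  have "(\<lambda>p. X p (coord \<kappa> j)) \<in> smooth_functions A (chart_dom \<kappa>)"
    using X atlas_chart(1)[OF A \<kappa>] coord_smooth[OF A \<kappa>] unfolding vector_fields_def by blast
  then have "smooth_on (chart_img \<kappa> (chart_dom \<kappa>)) ((\<lambda>p. X p (coord \<kappa> j)) \<circ> chart_inv \<kappa>)"
    by (rule smooth_functionsD[OF _ \<kappa>])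
  also have "(\<lambda>p. X p (coord \<kappa> j)) \<circ> chart_inv \<kappa> = vf_coeff \<kappa> X j"
    by (simp add: fun_eq_iff vf_coeff_def)
  finally show ?thesis by (rule smooth_on_subset) auto
qed

text \<open>Compatibility on overlaps is the change of variables formula for the transition map: the
  Jacobian factor in \<open>pull_test\<close> is exactly the one it produces. Boundedness of
  \<open>h\<close> makes all the integrals converge.\<close>

lemma mdistribution_of_bounded_function:
  fixes A :: "('m::{t2_space, second_countable_topology}, 'n::finite) chart set"
  assumes A: "smooth_atlas A" and U: "open U"
    and meas: "\<And>\<kappa>. \<kappa> \<in> A \<Longrightarrow>
      (\<lambda>y. indicator (chart_img \<kappa> U) y *\<^sub>R h (chart_inv \<kappa> y)) \<in> borel_measurable borel"
    and B: "\<And>q. q \<in> U \<Longrightarrow> cmod (h q) \<le> B"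
  shows "mdistribution A U (mdist_of_function U h)"
  unfolding mdistribution_def
proof (intro conjI ballI)
  have bound: "cmod (h (chart_inv \<kappa> y)) \<le> B" if "\<kappa> \<in> A" "y \<in> chart_img \<kappa> U" for \<kappa> y
    using B chart_img_inv(2)[OF A that] by blast
  show "distribution_on (chart_img \<kappa> U) (mdist_of_function U h \<kappa>)" if \<kappa>: "\<kappa> \<in> A" for \<kappa>
    unfolding mdist_of_function_def
    by (rule distribution_on_bounded_function[OF open_chart_img[OF A \<kappa> U] meas[OF \<kappa>] bound[OF \<kappa>]])
  fix \<kappa> \<kappa>' \<phi>
  assume \<kappa>: "\<kappa> \<in> A" and \<kappa>': "\<kappa>' \<in> A"
    and \<phi>: "\<phi> \<in> test_functions (chart_img \<kappa>' (chart_dom \<kappa> \<inter> U))"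
  let ?\<tau> = "transition \<kappa> \<kappa>'" and ?W = "chart_img \<kappa> U" and ?W' = "chart_img \<kappa>' U"
  let ?S = "chart_img \<kappa> (chart_dom \<kappa>' \<inter> U)" and ?S' = "chart_img \<kappa>' (chart_dom \<kappa> \<inter> U)"
  let ?d = "\<lambda>x. \<bar>det (matrix (frechet_derivative ?\<tau> (at x)))\<bar>"
  let ?F = "\<lambda>y. h (chart_inv \<kappa>' y) * \<phi> y"
  have inv: "chart_inv \<kappa>' (?\<tau> x) = chart_inv \<kappa> x" if "x \<in> ?S" for x
    using chart_img_inv[OF A \<kappa> that] chart_inv_map[OF A \<kappa>'] by simp
  have img: "?\<tau> ` ?S = ?S'"
  proof safe
    fix q assume q: "q \<in> chart_dom \<kappa>" "q \<in> chart_dom \<kappa>'" "q \<in> U"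
    then show "?\<tau> (chart_map \<kappa> q) \<in> ?S'"
      using chart_inv_map[OF A \<kappa>] by auto
    show "chart_map \<kappa>' q \<in> ?\<tau> ` ?S"
      using q chart_inv_map[OF A \<kappa>] by (intro image_eqI[of _ _ "chart_map \<kappa> q"]) auto
  qed
  have S: "open ?S" "open ?S'"
    by (intro open_chart_img[OF A] \<kappa> \<kappa>' open_Int U atlas_chart(1)[OF A])+
  have "smooth_on ?S ?\<tau>"
    by (rule smooth_on_subset[OF atlas_transition[OF A \<kappa> \<kappa>']]) auto
  then have \<tau>: "Ck_on (Suc 0) ?S ?\<tau>" by (rule smooth_on_Suc0)
  have inj: "inj_on ?\<tau> ?S"
  proof (rule inj_onI)
    fix x y assume xy: "x \<in> ?S" "y \<in> ?S" "?\<tau> x = ?\<tau> y"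
    from xy(3) have "chart_inv \<kappa>' (?\<tau> x) = chart_inv \<kappa>' (?\<tau> y)" by (rule arg_cong)
    then have "chart_inv \<kappa> x = chart_inv \<kappa> y" unfolding inv[OF xy(1)] inv[OF xy(2)] .
    then have "chart_map \<kappa> (chart_inv \<kappa> x) = chart_map \<kappa> (chart_inv \<kappa> y)" by (rule arg_cong)
    then show "x = y" unfolding chart_img_inv(3)[OF A \<kappa> xy(1)] chart_img_inv(3)[OF A \<kappa> xy(2)] .
  qed
  have cont_d: "continuous_on ?S ?d"
  proof -
    have "continuous_on ?S (\<lambda>x. frechet_derivative ?\<tau> (at x) (axis j 1) $ i)" for i j
      using \<tau> by (intro continuous_on_component) simp
    then show ?thesis
      unfolding det_def matrix_def vec_lambda_beta
      by (intro continuous_on_rabs continuous_on_sum continuous_on_mult continuous_on_const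
          continuous_on_prod)
  qed
  have \<phi>0: "\<phi> y = 0" if "y \<notin> ?S'" for y
    using test_function_outside[OF \<phi> that] .
  \<comment> \<open>Since \<open>\<phi>\<close> vanishes off the overlap, and so does its pullback
    by definition, both pairings become integrals over the overlap; there \<open>inv\<close> says
    that \<open>h\<close> is evaluated at the same point of the manifold in both charts.\<close>
  have F: "indicator ?W' y *\<^sub>R ?F y = indicator (?\<tau> ` ?S) y *\<^sub>R ?F y" for y
    unfolding img using \<phi>0[of y] by (cases "y \<in> ?S'") (auto simp: indicator_def)
  have P: "indicator ?W x *\<^sub>R (h (chart_inv \<kappa> x) * pull_test \<kappa> \<kappa>' U \<phi> x) =
      indicator ?S x *\<^sub>R (?d x *\<^sub>R ?F (?\<tau> x))" for x
  proof (cases "x \<in> ?S")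
    case True
    then have "x \<in> ?W" by auto
    then show ?thesis
      using True inv[OF True] by (simp add: pull_test_def scaleR_conv_of_real mult_ac)
  next
    case False
    then show ?thesis by (simp add: pull_test_def)
  qed
  have W': "integrable lborel (\<lambda>y. indicator ?W' y *\<^sub>R ?F y)"
      "integral\<^sup>L (lebesgue_on ?W') ?F = (\<integral>y. indicator ?W' y *\<^sub>R ?F y \<partial>lborel)"
    by (rule bounded_mult_test_function(2,3)[OF open_chart_img[OF A \<kappa>' U] meas[OF \<kappa>'] _ \<phi>];
        rule bound[OF \<kappa>']; assumption)+
  \<comment> \<open>The integrand is split into \<open>h\<close> read in the chart
    \<open>\<kappa>\<close>, measurable by hypothesis, and a factor that is continuous on
    \<open>?S\<close>.\<close>
  have D: "(\<lambda>x. indicator ?S x *\<^sub>R (?d x *\<^sub>R ?F (?\<tau> x))) \<in> borel_measurable borel"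
  proof -
    have "(\<lambda>x. (indicator ?W x *\<^sub>R h (chart_inv \<kappa> x)) * (indicator ?S x *\<^sub>R (?d x *\<^sub>R \<phi> (?\<tau> x)))) \<in> borel_measurable borel"
    proof (rule borel_measurable_times[OF meas[OF \<kappa>] borel_measurable_continuous_on_indicator])
      show "?S \<in> sets borel" using S by simp
      show "continuous_on ?S (\<lambda>x. ?d x *\<^sub>R \<phi> (?\<tau> x))"
        by (intro continuous_on_scaleR cont_d continuous_on_compose2[OF test_function_continuous[OF \<phi>]
              Ck1_continuous_on[OF \<tau>]] subset_UNIV)
    qed
    also have "(\<lambda>x. (indicator ?W x *\<^sub>R h (chart_inv \<kappa> x)) * (indicator ?S x *\<^sub>R (?d x *\<^sub>R \<phi> (?\<tau> x)))) =
        (\<lambda>x. indicator ?S x *\<^sub>R (?d x *\<^sub>R ?F (?\<tau> x)))"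
    proof
      fix x
      show "(indicator ?W x *\<^sub>R h (chart_inv \<kappa> x)) * (indicator ?S x *\<^sub>R (?d x *\<^sub>R \<phi> (?\<tau> x))) =
        indicator ?S x *\<^sub>R (?d x *\<^sub>R ?F (?\<tau> x))"
      proof (cases "x \<in> ?S")
        case True
        then have "x \<in> ?W" by auto
        then show ?thesis using True inv[OF True] by simp
      qed simp
    qed
    finally show ?thesis .
  qed
  have "mdist_of_function U h \<kappa>' \<phi> = (\<integral>y. indicator (?\<tau> ` ?S) y *\<^sub>R ?F y \<partial>lborel)"
    unfolding mdist_of_function_def W'(2) F ..
  also have "\<dots> = (\<integral>x. indicator ?S x *\<^sub>R (?d x *\<^sub>R ?F (?\<tau> x)) \<partial>lborel)"
  proof (rule integral_change_of_variables_complex[OF S(1) _ inj _ _ D])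
    show "(?\<tau> has_derivative frechet_derivative ?\<tau> (at x)) (at x)" if "x \<in> ?S" for x
      by (rule Ck1_has_derivative[OF \<tau> that])
    show "open (?\<tau> ` ?S)" unfolding img by (rule S(2))
    show "integrable lborel (\<lambda>y. indicator (?\<tau> ` ?S) y *\<^sub>R ?F y)"
      using W'(1) unfolding F .
  qed
  also have "\<dots> = mdist_of_function U h \<kappa> (pull_test \<kappa> \<kappa>' U \<phi>)"
    unfolding mdist_of_function_def P[symmetric]
    by (rule integral_lebesgue_on_lborel[symmetric])
      (use open_chart_img[OF A \<kappa> U] D in \<open>simp_all only: P borel_open\<close>)
  finally show "mdist_of_function U h \<kappa>' \<phi> = mdist_of_function U h \<kappa> (pull_test \<kappa> \<kappa>' U \<phi>)" .
qed

section \<open>The maximum principle\<close>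

text \<open>The complex derivative enters as a scalar factor, so a complex vector field that
  annihilates \<open>k\<close> also annihilates the composition: this is why holomorphic functions
  of CR functions are CR.\<close>

lemma Ck1_holomorphic_comp:
  fixes k :: "'a::euclidean_space \<Rightarrow> complex"
  assumes W: "open W" and k: "Ck_on (Suc 0) W k"
    and der: "\<And>x. x \<in> W \<Longrightarrow> (\<Psi> has_field_derivative \<Psi>' (k x)) (at (k x))"
    and cont: "continuous_on (k ` W) \<Psi>'"
  shows "Ck_on (Suc 0) W (\<lambda>x. \<Psi> (k x))"
    and "x \<in> W \<Longrightarrow> frechet_derivative (\<lambda>x. \<Psi> (k x)) (at x) v = \<Psi>' (k x) * frechet_derivative k (at x) v"
proof -
  have d: "((\<lambda>x. \<Psi> (k x)) has_derivative (\<lambda>v. \<Psi>' (k x) * frechet_derivative k (at x) v)) (at x)"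
    if "x \<in> W" for x
    using has_derivative_compose[OF Ck1_has_derivative[OF k that] der[OF that, unfolded has_field_derivative_def]]
    by simp
  show "Ck_on (Suc 0) W (\<lambda>x. \<Psi> (k x))"
  proof (rule Ck1_onI[OF W d])
    show "continuous_on W (\<lambda>x. \<Psi>' (k x) * frechet_derivative k (at x) v)" for v
      using k by (intro continuous_on_mult continuous_on_compose2[OF cont Ck1_continuous_on[OF k]]) auto
  qed
  show "x \<in> W \<Longrightarrow> frechet_derivative (\<lambda>x. \<Psi> (k x)) (at x) v = \<Psi>' (k x) * frechet_derivative k (at x) v"
    using frechet_derivative_eqI[OF d] by simp
qed

lemma Re_1_minus_div_nonneg:
  assumes "c \<noteq> 0" "cmod z \<le> cmod c"
  shows "0 \<le> Re (1 - z / c)"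
proof -
  have "Re (z / c) \<le> cmod (z / c)" by (rule complex_Re_le_cmod)
  also have "\<dots> \<le> 1" using assms by (simp add: norm_divide divide_le_eq)
  finally show ?thesis by simp
qed

definition osc_at :: "complex \<Rightarrow> nat \<Rightarrow> complex \<Rightarrow> complex" where
  "osc_at c n z = osc (1 - z / c + of_real (osc_shift n))"

text \<open>The positive shift moves the closed half-plane into the open one, hence off the branch
  cut of \<open>Ln\<close>, so the formula holds on the whole closed disc, including the point
  \<open>z = c\<close>.\<close>

lemma osc_at_has_field_derivative:
  assumes "c \<noteq> 0" "cmod z \<le> cmod c"
  shows "(osc_at c n has_field_derivative
    osc_at c n z * (- \<i> / (c * (1 - z / c + of_real (osc_shift n))))) (at z)"
    and "1 - z / c + of_real (osc_shift n) \<noteq> 0"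
proof -
  let ?w = "\<lambda>z. 1 - z / c + of_real (osc_shift n)"
  have "0 < Re (?w z)"
    using Re_1_minus_div_nonneg[OF assms] by (simp add: osc_shift_def add_nonneg_pos)
  then have nn: "?w z \<notin> \<real>\<^sub>\<le>\<^sub>0" by (rule Re_pos_notin_nonpos)
  then show nz: "?w z \<noteq> 0" by auto
  have "(?w has_field_derivative - (1 / c)) (at z)"
    using assms(1) by (auto intro!: derivative_eq_intros)
  from DERIV_chain2[OF osc_has_field_derivative[OF nn] this]
  have "(osc_at c n has_field_derivative osc (?w z) * (\<i> / ?w z) * - (1 / c)) (at z)"
    unfolding osc_at_def[abs_def] .
  also have "osc (?w z) * (\<i> / ?w z) * - (1 / c) = osc_at c n z * (- \<i> / (c * ?w z))"
    by (simp add: osc_at_def)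
  finally show "(osc_at c n has_field_derivative osc_at c n z * (- \<i> / (c * ?w z))) (at z)" .
qed

section \<open>The bounded CR distribution attached to a CR function with modulus at most
  \<open>cmod c\<close>\<close>

context
  fixes A :: "('m::{t2_space, second_countable_topology}, 'n::finite) chart set"
    and Z :: "'m set \<Rightarrow> 'm vfield set" and U :: "'m set" and f :: "'m \<Rightarrow> complex" and c :: complex
  assumes A: "smooth_atlas A" and Z: "Z UNIV \<subseteq> vector_fields A UNIV"
    and U: "open U" and f: "f \<in> CR_functions A Z U"
    and c: "c \<noteq> 0" and le: "\<And>q. q \<in> U \<Longrightarrow> cmod (f q) \<le> cmod c"
begin

abbreviation (input) osc_of_f :: "'m \<Rightarrow> complex" where
  "osc_of_f \<equiv> \<lambda>q. osc (1 - f q / c)"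

lemma CR_function_smooth: "f \<in> smooth_functions A U"
  using f by (simp add: CR_functions_def)

lemma Re_1_minus_f_nonneg: "q \<in> U \<Longrightarrow> 0 \<le> Re (1 - f q / c)"
  by (rule Re_1_minus_div_nonneg[OF c le])

lemma osc_of_f_bound: "q \<in> U \<Longrightarrow> cmod (osc_of_f q) \<le> exp (pi / 2)"
  by (rule norm_osc_le[OF Re_1_minus_f_nonneg])

lemma osc_at_f_lim: "q \<in> U \<Longrightarrow> (\<lambda>n. osc_at c n (f q)) \<longlonglongrightarrow> osc_of_f q"
  unfolding osc_at_def by (rule osc_shift_lim[OF Re_1_minus_f_nonneg])

lemma osc_at_f_bound: "q \<in> U \<Longrightarrow> cmod (osc_at c n (f q)) \<le> exp (pi / 2)"
  unfolding osc_at_def using Re_1_minus_f_nonneg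
  by (intro norm_osc_le) (simp add: osc_shift_def)

lemma osc_at_f_chart:
  assumes \<kappa>: "\<kappa> \<in> A"
  shows "Ck_on (Suc 0) (chart_img \<kappa> U) (\<lambda>y. osc_at c n (f (chart_inv \<kappa> y)))"
    and "y \<in> chart_img \<kappa> U \<Longrightarrow> \<exists>d. \<forall>j. partial j (\<lambda>y. osc_at c n (f (chart_inv \<kappa> y))) y =
      d * partial j (f \<circ> chart_inv \<kappa>) y"
proof -
  let ?W = "chart_img \<kappa> U" and ?k = "f \<circ> chart_inv \<kappa>"
  let ?D = "\<lambda>z. osc_at c n z * (- \<i> / (c * (1 - z / c + of_real (osc_shift n))))"
  have W: "open ?W" by (rule open_chart_img[OF A \<kappa> U])
  have k: "Ck_on (Suc 0) ?W ?k"
    by (rule smooth_on_Suc0[OF smooth_functionsD[OF CR_function_smooth \<kappa>]])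
  have b: "cmod (?k y) \<le> cmod c" if "y \<in> ?W" for y
    using le chart_img_inv(2)[OF A \<kappa> that] by simp
  have der: "(osc_at c n has_field_derivative ?D (?k y)) (at (?k y))" if "y \<in> ?W" for y
    by (rule osc_at_has_field_derivative(1)[OF c b[OF that]])
  have sub: "?k ` ?W \<subseteq> {z. cmod z \<le> cmod c}" using b by blast
  have cont: "continuous_on {z. cmod z \<le> cmod c} ?D"
  proof (intro continuous_intros ballI)
    show "continuous_on {z. cmod z \<le> cmod c} (osc_at c n)"
      by (intro continuous_at_imp_continuous_on ballI DERIV_isCont[OF osc_at_has_field_derivative(1)[OF c]]) simp
    show "c * (1 - z / c + of_real (osc_shift n)) \<noteq> 0" if "z \<in> {z. cmod z \<le> cmod c}" for z
      using osc_at_has_field_derivative(2)[OF c, of z n] that c by simp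
  qed (use c in auto)
  have comp: "Ck_on (Suc 0) ?W (\<lambda>y. osc_at c n (?k y))"
      "y \<in> ?W \<Longrightarrow> frechet_derivative (\<lambda>y. osc_at c n (?k y)) (at y) v =
        ?D (?k y) * frechet_derivative ?k (at y) v" for y v
    by (rule Ck1_holomorphic_comp[OF W k _ continuous_on_subset[OF cont sub]]; (rule der)?; assumption)+
  show "Ck_on (Suc 0) ?W (\<lambda>y. osc_at c n (f (chart_inv \<kappa> y)))"
    using comp(1) by simp
  show "\<exists>d. \<forall>j. partial j (\<lambda>y. osc_at c n (f (chart_inv \<kappa> y))) y = d * partial j ?k y"
    if "y \<in> ?W"
    using comp(2)[OF that] by (intro exI[of _ "?D (?k y)"]) (simp add: partial_def)
qed

text \<open>\<open>osc\<close> is not continuous at 0, so measurability is inherited from the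
  approximants, which are continuous in the chart.\<close>

lemma osc_of_f_measurable:
  assumes \<kappa>: "\<kappa> \<in> A"
  shows "(\<lambda>y. indicator (chart_img \<kappa> U) y *\<^sub>R osc_of_f (chart_inv \<kappa> y)) \<in> borel_measurable borel"
proof (rule borel_measurable_LIMSEQ_metric)
  show "(\<lambda>y. indicator (chart_img \<kappa> U) y *\<^sub>R osc_at c n (f (chart_inv \<kappa> y))) \<in> borel_measurable borel" for n
    using open_chart_img[OF A \<kappa> U]
    by (intro borel_measurable_continuous_on_indicator Ck1_continuous_on[OF osc_at_f_chart(1)[OF \<kappa>]]) simp
  show "(\<lambda>n. indicator (chart_img \<kappa> U) y *\<^sub>R osc_at c n (f (chart_inv \<kappa> y))) \<longlonglongrightarrow>
      indicator (chart_img \<kappa> U) y *\<^sub>R osc_of_f (chart_inv \<kappa> y)" for y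
  proof (cases "y \<in> chart_img \<kappa> U")
    case True
    then show ?thesis
      using osc_at_f_lim[OF chart_img_inv(2)[OF A \<kappa> True]] by (intro tendsto_intros)
  qed simp
qed

text \<open>The approximants are annihilated classically: their partial derivatives are those of
  \<open>f\<close> times one factor \<open>d\<close> that is the same for every \<open>j\<close>.
  \<open>limit_annihilated_weakly\<close> passes this to the limit.\<close>

lemma osc_of_f_CR_distribution: "CR_distribution A Z U (mdist_of_function U osc_of_f)"
  unfolding CR_distribution_def
proof (intro conjI ballI)
  show "mdistribution A U (mdist_of_function U osc_of_f)"
    by (rule mdistribution_of_bounded_function[OF A U osc_of_f_measurable osc_of_f_bound])
  fix X assume X: "X \<in> Z UNIV"
  then have XV: "X \<in> vector_fields A UNIV" using Z by blast
  show "mdist_eq_on A U (vf_apply_mdist X (mdist_of_function U osc_of_f)) (\<lambda>\<kappa> \<phi>. 0)"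
    unfolding mdist_eq_on_def
  proof (intro ballI)
    fix \<kappa> \<phi> assume \<kappa>: "\<kappa> \<in> A" and \<phi>: "\<phi> \<in> test_functions (chart_img \<kappa> U)"
    let ?W = "chart_img \<kappa> U" and ?a = "vf_coeff \<kappa> X" and ?h = "\<lambda>y. osc_of_f (chart_inv \<kappa> y)"
    \<comment> \<open>Multiplication is applied after differentiation in
      \<open>vf_apply_mdist\<close>, so by duality the coefficient ends up inside the derivative of
      the test function.\<close>
    let ?S = "\<lambda>j. partial j (\<lambda>y. ?a j y * \<phi> y)"
    have W: "open ?W" by (rule open_chart_img[OF A \<kappa> U])
    have a: "Ck_on (Suc 0) ?W (?a j)" for j
      by (rule smooth_on_Suc0[OF vf_coeff_smooth[OF A \<kappa> XV]])
    have "continuous_on ?W (?S j)" for j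
      using Ck1_mult_test_function(1)[OF W a \<phi>, of j] by (simp add: partial_def[abs_def])
    then have int: "integral\<^sup>L (lebesgue_on ?W) (\<lambda>y. ?h y * ?S j y) =
        (\<integral>y. indicator ?W y *\<^sub>R (?h y * ?S j y) \<partial>lborel)" for j
      by (intro integral_lebesgue_on_lborel borel_open[OF W]
          indicator_mult_measurable[OF osc_of_f_measurable[OF \<kappa>]])
    have "(\<Sum>j\<in>UNIV. \<integral>y. indicator ?W y *\<^sub>R (?h y * ?S j y) \<partial>lborel) = 0"
    proof (rule limit_annihilated_weakly[OF W osc_at_f_chart(1)[OF \<kappa>] _ a _ _ \<phi>])
      fix n y assume y: "y \<in> ?W"
      note q = chart_img_inv(2)[OF A \<kappa> y]
      obtain d where d: "\<And>j. partial j (\<lambda>y. osc_at c n (f (chart_inv \<kappa> y))) y = d * partial j (f \<circ> chart_inv \<kappa>) y"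
        using osc_at_f_chart(2)[OF \<kappa> y] by blast
      have "X (chart_inv \<kappa> y) f = 0" using f X q by (simp add: CR_functions_def)
      then have "(\<Sum>j\<in>UNIV. ?a j y * partial j (f \<circ> chart_inv \<kappa>) y) = 0"
        unfolding vector_field_in_chart[OF A \<kappa> XV y U CR_function_smooth] .
      then have "d * (\<Sum>j\<in>UNIV. ?a j y * partial j (f \<circ> chart_inv \<kappa>) y) = 0" by simp
      then show "(\<Sum>j\<in>UNIV. ?a j y * partial j (\<lambda>y. osc_at c n (f (chart_inv \<kappa> y))) y) = 0"
        unfolding d by (simp only: sum_distrib_left mult.left_commute[of d])
      show "(\<lambda>n. osc_at c n (f (chart_inv \<kappa> y))) \<longlonglongrightarrow> ?h y" by (rule osc_at_f_lim[OF q])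
      show "cmod (osc_at c n (f (chart_inv \<kappa> y))) \<le> exp (pi / 2)" by (rule osc_at_f_bound[OF q])
    qed
    then show "vf_apply_mdist X (mdist_of_function U osc_of_f) \<kappa> \<phi> = 0"
      by (simp add: vf_apply_mdist_def dist_mult_def dist_partial_def mdist_of_function_def int sum_negf)
  qed
qed

lemma osc_of_f_locally_L2: "locally_L2 A U (mdist_of_function U osc_of_f)"
  unfolding locally_L2_def
proof (intro exI[of _ osc_of_f] conjI ballI)
  fix \<kappa> assume \<kappa>: "\<kappa> \<in> A"
  show "L2_loc (chart_img \<kappa> U) (osc_of_f \<circ> chart_inv \<kappa>)"
    unfolding o_def
    by (rule L2_loc_bounded[OF open_chart_img[OF A \<kappa> U] osc_of_f_measurable[OF \<kappa>]])
      (rule osc_of_f_bound[OF chart_img_inv(2)[OF A \<kappa>]])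
qed (simp add: mdist_eq_on_def)

text \<open>The oscillation of \<open>osc\<close> at 0 is played off against the continuity of the
  smooth representative: on a small ball around \<open>p\<close> that representative varies too
  little to follow \<open>osc (w y)\<close> unless \<open>w\<close> vanishes on the ball.\<close>

lemma smooth_osc_imp_locally_const:
  assumes V: "open V" "V \<subseteq> U" and sm: "smooth_mdist A V (mdist_of_function U osc_of_f)"
    and p: "p \<in> V" "f p = c"
  shows "\<exists>N. open N \<and> p \<in> N \<and> N \<subseteq> {q \<in> U. f q = c}"
proof -
  obtain g where g: "g \<in> smooth_functions A V"
    and eq: "mdist_eq_on A V (mdist_of_function U osc_of_f) (mdist_of_function V g)"
    using sm unfolding smooth_mdist_def by blast
  obtain \<kappa> where \<kappa>: "\<kappa> \<in> A" "p \<in> chart_dom \<kappa>" by (rule atlas_covers[OF A])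
  let ?W = "chart_img \<kappa> V" and ?WU = "chart_img \<kappa> U"
  define w where "w y = 1 - f (chart_inv \<kappa> y) / c" for y
  define G where "G = g \<circ> chart_inv \<kappa>"
  define y0 where "y0 = chart_map \<kappa> p"
  have W: "open ?W" "open ?WU" by (rule open_chart_img[OF A \<kappa>(1)]; rule V U)+
  have WU: "?W \<subseteq> ?WU" using V(2) by blast
  have y0: "y0 \<in> ?W" using p \<kappa> by (simp add: y0_def)
  have w0: "w y0 = 0" using c p by (simp add: w_def y0_def chart_inv_map[OF A \<kappa>])
  have G: "continuous_on ?W G"
    unfolding G_def by (rule smooth_on_continuous_on[OF smooth_functionsD[OF g \<kappa>(1)]])
  have "continuous_on ?WU (f \<circ> chart_inv \<kappa>)"
    by (rule smooth_on_continuous_on[OF smooth_functionsD[OF CR_function_smooth \<kappa>(1)]])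
  then have w: "continuous_on ?W w"
    unfolding w_def[abs_def] o_def using c by (intro continuous_intros continuous_on_subset[OF _ WU]) auto
  have Re_w: "0 \<le> Re (w y)" if "y \<in> ?W" for y
    unfolding w_def using Re_1_minus_f_nonneg chart_img_inv(2)[OF A \<kappa>(1) that] V(2) by blast
  \<comment> \<open>On this open set both \<open>osc (w y)\<close> and \<open>G\<close> are
    continuous, so equality as distributions becomes equality at every point. Nothing is claimed on
    the zero set of \<open>w\<close>, where the value of \<open>osc\<close> was a mere
    convention.\<close>
  define W0 where "W0 = w -` (- {0}) \<inter> ?W"
  have W0: "open W0" unfolding W0_def
    by (rule continuous_on_open_vimage[OF W(1), THEN iffD1, rule_format, OF w]) (rule open_Compl, rule closed_singleton)
  have osc_w: "continuous_on W0 (\<lambda>y. osc (w y))"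
  proof (rule continuous_at_imp_continuous_on, rule ballI)
    fix y assume y: "y \<in> W0"
    have "isCont w y"
      using w y unfolding W0_def continuous_on_eq_continuous_at[OF W(1)] by blast
    moreover have "isCont osc (w y)"
      using y Re_w by (intro isCont_osc Re_nonneg_notin_nonpos) (auto simp: W0_def)
    ultimately show "isCont (\<lambda>y. osc (w y)) y" by (rule isCont_o2)
  qed
  have GW0: "continuous_on W0 G"
    by (rule continuous_on_subset[OF G]) (simp add: W0_def)
  have G_eq: "osc (w y) = G y" if y: "y \<in> W0" for y
  proof (rule continuous_weakly_eq_imp_eq[OF W0 osc_w GW0 _ y])
    fix \<phi> assume \<phi>: "\<phi> \<in> test_functions W0"
    have "W0 \<subseteq> ?W" by (simp add: W0_def)
    then have \<phi>W: "\<phi> \<in> test_functions ?W" using \<phi> test_functions_mono by blast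
    \<comment> \<open>The two distributions are integrals over different sets, \<open>?WU\<close>
      and \<open>?W\<close>; a test function supported in \<open>W0\<close> reduces both to
      \<open>W0\<close>.\<close>
    have restrict: "integral\<^sup>L (lebesgue_on S) (\<lambda>y. k y * \<phi> y) = (\<integral>y. indicator W0 y *\<^sub>R (k y * \<phi> y) \<partial>lborel)"
      if S: "open S" "W0 \<subseteq> S" and k: "continuous_on W0 k" for S and k :: "real^'n \<Rightarrow> complex"
    proof -
      have ind: "indicator S y *\<^sub>R (k y * \<phi> y) = indicator W0 y *\<^sub>R (k y * \<phi> y)" for y
        using S(2) test_function_outside[OF \<phi>, of y] by (cases "y \<in> W0") auto
      have "(\<lambda>y. indicator W0 y *\<^sub>R (k y * \<phi> y)) \<in> borel_measurable borel"
        using W0 by (intro borel_measurable_continuous_on_indicator continuous_on_mult k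
            continuous_on_subset[OF test_function_continuous[OF \<phi>] subset_UNIV]) simp
      then show ?thesis
        using S(1) by (subst integral_lebesgue_on_lborel) (simp_all only: ind borel_open)
    qed
    have "mdist_of_function U osc_of_f \<kappa> \<phi> = mdist_of_function V g \<kappa> \<phi>"
      using eq \<kappa>(1) \<phi>W unfolding mdist_eq_on_def by blast
    then have "integral\<^sup>L (lebesgue_on ?WU) (\<lambda>y. osc (w y) * \<phi> y) = integral\<^sup>L (lebesgue_on ?W) (\<lambda>y. G y * \<phi> y)"
      by (simp only: mdist_of_function_def w_def G_def o_apply)
    moreover have "W0 \<subseteq> ?WU" "W0 \<subseteq> ?W" using WU by (auto simp: W0_def)
    ultimately show "(\<integral>y. indicator W0 y *\<^sub>R (osc (w y) * \<phi> y) \<partial>lborel) =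
        (\<integral>y. indicator W0 y *\<^sub>R (G y * \<phi> y) \<partial>lborel)"
      using restrict[OF W(2) _ osc_w] restrict[OF W(1) _ GW0] by simp
  qed
  \<comment> \<open>By \<open>Re_osc_oscillates\<close> there are values of the real part above
    \<open>e\<close> or equal to it and values at most \<open>- e\<close>. They differ by at least
    \<open>2 * e\<close>, so they cannot both lie within less than \<open>e\<close> of
    \<open>Re (G y0)\<close>.\<close>
  define e where "e = exp (- (pi / 2))"
  have "isCont G y0" using G y0 unfolding continuous_on_eq_continuous_at[OF W(1)] by blast
  then obtain d1 where d1: "d1 > 0" "\<And>y. dist y y0 < d1 \<Longrightarrow> dist (G y) (G y0) < e"
    unfolding continuous_at_eps_delta using exp_gt_zero[of "- (pi / 2)"] e_def by blast
  obtain d2 where d2: "d2 > 0" "ball y0 d2 \<subseteq> ?W"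
    using W(1) y0 open_contains_ball by blast
  define B where "B = ball y0 (min d1 d2)"
  have B: "B \<subseteq> ?W" "y0 \<in> B" "open B" "connected B"
    using d1(1) d2 by (auto simp: B_def)
  have GB: "dist (G y) (G y0) < e" if "y \<in> B" for y
    using d1(2)[of y] that by (simp add: B_def dist_commute)
  have wB: "w y = 0" if y1: "y \<in> B" for y
  proof (rule ccontr)
    assume "w y \<noteq> 0"
    have cw: "connected ((\<lambda>y. cmod (w y)) ` B)"
      by (intro connected_continuous_image B continuous_on_norm continuous_on_subset[OF w])
    \<comment> \<open>The interval starts at 0 because \<open>w y0 = 0\<close>, and the ball
      \<open>B\<close> is connected.\<close>
    have ivt: "\<exists>y'\<in>B. cmod (w y') = t" if "0 \<le> t" "t \<le> cmod (w y)" for t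
    proof -
      have "0 \<in> (\<lambda>y. cmod (w y)) ` B" "cmod (w y) \<in> (\<lambda>y. cmod (w y)) ` B"
        using B(2) w0 y1 by (auto intro: image_eqI[of _ _ y0])
      then have "t \<in> (\<lambda>y. cmod (w y)) ` B"
        by (rule connectedD_interval[OF cw _ _ that])
      then show ?thesis by blast
    qed
    \<comment> \<open>A radius of the first kind below \<open>cmod (w y)\<close> is enough: the
      radius of the second kind with the same \<open>k\<close> is smaller still.\<close>
    have "(\<lambda>k. exp (- (2 * pi * real k))) \<longlonglongrightarrow> 0" by real_asymp
    then have "eventually (\<lambda>k. exp (- (2 * pi * real k)) < cmod (w y)) sequentially"
      using \<open>w y \<noteq> 0\<close> by (intro order_tendstoD(2)) auto
    then obtain k where k: "exp (- (2 * pi * real k)) < cmod (w y)"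
      by (auto simp: eventually_sequentially)
    have k': "exp (- (2 * pi * real k + pi)) < cmod (w y)"
      by (rule le_less_trans[OF _ k]) simp
    obtain a where a: "a \<in> B" "cmod (w a) = exp (- (2 * pi * real k))"
      using ivt[OF exp_ge_zero less_imp_le[OF k]] by blast
    obtain b where b: "b \<in> B" "cmod (w b) = exp (- (2 * pi * real k + pi))"
      using ivt[OF exp_ge_zero less_imp_le[OF k']] by blast
    have nz: "w a \<noteq> 0" "w b \<noteq> 0" using a(2) b(2) by auto
    have W0ab: "a \<in> W0" "b \<in> W0" using a b B(1) nz by (auto simp: W0_def)
    have "Re (G a) \<ge> e" "Re (G b) \<le> - e"
      unfolding G_eq[OF W0ab(1), symmetric] G_eq[OF W0ab(2), symmetric] e_def
      using Re_osc_oscillates(1)[OF Re_w a(2)] Re_osc_oscillates(2)[OF Re_w b(2)] a(1) b(1) B(1)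
      by blast+
    moreover have "\<bar>Re (G a) - Re (G y0)\<bar> < e" "\<bar>Re (G b) - Re (G y0)\<bar> < e"
      using GB[OF a(1)] GB[OF b(1)] abs_Re_le_cmod[of "G a - G y0"] abs_Re_le_cmod[of "G b - G y0"]
      by (simp_all add: dist_norm)
    ultimately show False by linarith
  qed
  let ?N = "chart_map \<kappa> -` B \<inter> chart_dom \<kappa>"
  have "open ?N" by (rule open_chart_vimage[OF A \<kappa>(1) B(3)])
  moreover have "p \<in> ?N" using \<kappa> B(2) by (simp add: y0_def)
  moreover have "?N \<subseteq> {q \<in> U. f q = c}"
  proof
    fix q assume q: "q \<in> ?N"
    then have inv: "chart_inv \<kappa> (chart_map \<kappa> q) = q" using chart_inv_map[OF A \<kappa>(1)] by simp
    have "chart_map \<kappa> q \<in> ?W" using q B(1) by blast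
    then have "q \<in> U" using chart_img_inv(2)[OF A \<kappa>(1)] V(2) inv by fastforce
    moreover have "f q = c" using wB[of "chart_map \<kappa> q"] q c by (simp add: w_def inv)
    ultimately show "q \<in> {q \<in> U. f q = c}" by simp
  qed
  ultimately show ?thesis by blast
qed

end

theorem proposition2p1:
  fixes A :: "('m::{t2_space, second_countable_topology}, 'n::finite) chart set"
    and Z :: "'m set \<Rightarrow> 'm vfield set"
    and \<Omega> :: "'m set"
    and f :: "'m \<Rightarrow> complex"
    and p :: 'm
  assumes "Z_manifold A Z"
    and "L2_CR_germs_smooth A Z"
    and "open \<Omega>"
    and "connected \<Omega>"
    and "f \<in> CR_functions A Z \<Omega>"
    and "\<not> f constant_on \<Omega>"
    and "p \<in> \<Omega>"
  shows "ereal (cmod (f p)) < (SUP q\<in>\<Omega>. ereal (cmod (f q)))"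
proof (rule ccontr)
  assume "\<not> ?thesis"
  \<comment> \<open>An unbounded \<open>f\<close> has supremum infinity in \<open>ereal\<close>, so
    the negated claim includes that \<open>f\<close> is bounded.\<close>
  then have "(SUP q\<in>\<Omega>. ereal (cmod (f q))) \<le> ereal (cmod (f p))" by simp
  then have "ereal (cmod (f q)) \<le> ereal (cmod (f p))" if "q \<in> \<Omega>" for q
    using SUP_upper[OF that, of "\<lambda>q. ereal (cmod (f q))"] by (rule order_trans[rotated])
  then have max: "cmod (f q) \<le> cmod (f p)" if "q \<in> \<Omega>" for q using that by simp
  have nz: "f p \<noteq> 0"
  proof
    assume "f p = 0"
    then have "\<forall>q\<in>\<Omega>. f q = 0" using max by simp
    then have "f constant_on \<Omega>" unfolding constant_on_def by blast
    then show False using assms(6) by blast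
  qed
  have A: "smooth_atlas A" and sheaf: "vf_submodule_sheaf A Z"
    using assms(1) by (simp_all add: Z_manifold_def)
  have Z: "Z UNIV \<subseteq> vector_fields A UNIV"
    using sheaf[unfolded vf_submodule_sheaf_def, rule_format, OF open_UNIV] by (rule conjunct1)
  note ctxt = A Z assms(3) assms(5) nz
  let ?u = "mdist_of_function \<Omega> (\<lambda>q. osc (1 - f q / f p))"
  let ?F = "{q \<in> \<Omega>. f q = f p}"
  \<comment> \<open>The distribution \<open>?u\<close> is fixed. Every point of \<open>?F\<close>
    has the same value \<open>f p\<close>, so the germ of \<open>?u\<close> at any of them can take
    the place of the germ at \<open>p\<close>.\<close>
  have loc: "\<exists>N. open N \<and> q \<in> N \<and> N \<subseteq> ?F" if q: "q \<in> ?F" for q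
  proof -
    have "q \<in> \<Omega>" using q by simp
    moreover have "CR_distribution A Z \<Omega> ?u" "locally_L2 A \<Omega> ?u"
      by (rule osc_of_f_CR_distribution[OF ctxt(1-5)] osc_of_f_locally_L2[OF ctxt(1-5)]; rule max; assumption)+
    ultimately obtain V where V: "open V" "q \<in> V" "V \<subseteq> \<Omega>" "smooth_mdist A V ?u"
      using assms(2,3) unfolding L2_CR_germs_smooth_def by blast
    show ?thesis
      by (rule smooth_osc_imp_locally_const[OF ctxt(1-5) _ V(1) V(3) V(4) V(2)])
        (use max q in auto)
  qed
  have "open ?F" by (rule topological_space_class.openI) (rule loc)
  then have "openin (top_of_set \<Omega>) ?F" by (auto intro: open_openin_trans[OF assms(3)])
  moreover have "closedin (top_of_set \<Omega>) ?F"
    using smooth_functions_continuous_on[OF A assms(3)] assms(5)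
    by (intro continuous_closedin_preimage_constant) (simp add: CR_functions_def)
  ultimately have "?F = {} \<or> ?F = \<Omega>"
    using assms(4) unfolding connected_clopen by blast
  then have "?F = \<Omega>" using assms(7) by blast
  then have "f constant_on \<Omega>" unfolding constant_on_def by blast
  then show False using assms(6) by blast
qed

end
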